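(* Let $N\ge 3$, let $w_1,\dots,w_r\in\mathbb{R}^N$ be pairwise distinct points not contained in any real affine plane, and let $F(x)=\prod_{j=1}^r|x-w_j|^2$. Assume that $F$ is a local Morse function on $\mathbb{R}^N$, i.e. every critical point of $F$ has nondegenerate Hessian. Then $F$ has finitely many critical points: its $r$ absolute minima $w_1,\dots,w_r$, some number $h\ge 0$ of local minima in $\mathbb{R}^N\setminus\{w_1,\dots,w_r\}$, and exactly $r+h-1$ further critical points, each of negativity index $1$; there are no other critical points.
   Context: $|\cdot|$ is the Euclidean norm. The negativity index of a nondegenerate critical point is the number of negative eigenvalues of the Hessian there. *)

theory Defs
  imports "HOL-Analysis.Analysis" "HOL-Computational_Algebra.Polynomial"
begin

definition critical_point :: "(real^'n \<Rightarrow> real) \<Rightarrow> real^'n \<Rightarrow> bool" where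
  "critical_point f x \<longleftrightarrow> (f has_derivative (\<lambda>_. 0)) (at x)"

definition partial_deriv :: "(real^'n \<Rightarrow> real) \<Rightarrow> 'n \<Rightarrow> real^'n \<Rightarrow> real" where
  "partial_deriv f i x = deriv (\<lambda>t. f (x + t *\<^sub>R axis i 1)) 0"

definition hessian :: "(real^'n \<Rightarrow> real) \<Rightarrow> real^'n \<Rightarrow> real^'n^'n" where
  "hessian f x = (\<chi> i j. partial_deriv (\<lambda>y. partial_deriv f j y) i x)"

definition charpoly :: "real^'n^'n \<Rightarrow> real poly" where
  "charpoly A = det (\<chi> i j. (if i = j then [:0, 1:] else 0) - [: A $ i $ j :])"

definition negativity_index :: "real^'n^'n \<Rightarrow> nat" where
  "negativity_index A =
     (\<Sum>a\<in>{a. a < 0 \<and> poly (charpoly A) a = 0}. order a (charpoly A))"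

definition local_min_at :: "(real^'n \<Rightarrow> real) \<Rightarrow> real^'n \<Rightarrow> bool" where
  "local_min_at f x \<longleftrightarrow> (\<exists>e>0. \<forall>y. dist y x < e \<longrightarrow> f x \<le> f y)"

end

theory Submission
  imports Defs
begin

text \<open>At a critical point outside \<open>W = {w_1, ..., w_r}\<close> the Hessian of \<open>F\<close> is a positive multiple of
  the Hessian of \<open>log F\<close>, whose trace on every two-dimensional subspace is nonnegative, with
  equality only if all \<open>w_j\<close> lie in one affine plane. Hence at most one eigenvalue is negative:
  a critical point is a local minimum, with positive Hessian determinant, or has index \<open>1\<close>, with
  negative determinant. Since \<open>x \<bullet> \<nabla>F x > 0\<close> for large \<open>x\<close>, the gradient has Brouwer degree \<open>1\<close> on a
  large ball, so the signs of the Hessian determinants add up to \<open>1\<close>; this is the required count.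

  The degree is handled analytically, through the integral of \<open>\<phi>(G x) det(G' x)\<close> for a bump function
  \<open>\<phi>\<close> of small support. Its derivative along a homotopy is an integral of determinants in which one row
  of the Jacobian is replaced by the gradient of a compactly supported function, and such integrals
  vanish. Only radial symmetry of \<open>\<phi>\<close> is needed to evaluate it at isometries, so no change of
  variables occurs.\<close>

text \<open>For \<open>u = x - w_j\<close>, the second derivative of \<open>log |u|^2\<close> in a
  unit direction \<open>a\<close> is \<open>2/|u|^2 - 4 (u . a)^2/|u|^4\<close>. Summed over
  orthonormal \<open>a\<close>, \<open>b\<close> this gives
  \<open>4 (|u|^2 - (u . a)^2 - (u . b)^2)/|u|^4\<close>, that is, four times the squared distance
  of \<open>u\<close> from the span of \<open>a\<close> and \<open>b\<close>, divided by
  \<open>|u|^4\<close>. It vanishes for all \<open>j\<close> only if every \<open>w_j\<close> lies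
  in the plane \<open>x + span {a, b}\<close>. Two orthogonal eigenvectors with negative eigenvalues
  would make such a sum negative. The points \<open>w_j\<close> need no Hessian computation: they
  are minima, so the Morse hypothesis forces a positive determinant there. With \<open>h\<close>
  other local minima and \<open>s\<close> saddles, the signs add up to \<open>r + h - s = 1\<close>.
  Since \<open>F\<close> is a polynomial, symmetry of second derivatives is an induction over
  polynomial expressions, and C^1 bump functions suffice. Jacobians of gradients are symmetric, so
  the local degree follows from the spectral theorem, without studying the components of the general
  linear group.\<close>

section \<open>Partial derivatives of polynomial functions\<close>

text \<open>\<open>deriv\<close> is a description operator, meaningful only where a derivative
  exists. This is the bridge from \<open>partial_deriv\<close> to Frechet derivatives through which
  all later computations pass.\<close>

lemma partial_deriv_eq:
  fixes f :: "real^'n \<Rightarrow> real"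
  assumes "(f has_derivative f') (at x)"
  shows "partial_deriv f i x = f' (axis i 1)"
proof -
  have lin: "linear f'" using assms has_derivative_linear by blast
  have "((\<lambda>t. x + t *\<^sub>R axis i 1) has_derivative (\<lambda>t. t *\<^sub>R axis i 1)) (at (0::real))"
    by (auto intro!: derivative_eq_intros)
  moreover have "(f has_derivative f') (at (x + 0 *\<^sub>R axis i 1))" using assms by simp
  ultimately have "((\<lambda>t. f (x + t *\<^sub>R axis i 1)) has_derivative (\<lambda>t. f' (t *\<^sub>R axis i 1))) (at 0)"
    by (rule has_derivative_compose)
  then have "((\<lambda>t. f (x + t *\<^sub>R axis i 1)) has_field_derivative f' (axis i 1)) (at 0)"
    unfolding has_field_derivative_def
    by (rule has_derivative_eq_rhs) (simp add: fun_eq_iff linear_scale[OF lin])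
  then show ?thesis unfolding partial_deriv_def by (rule DERIV_imp_deriv)
qed

definition gradient :: "(real^'n \<Rightarrow> real) \<Rightarrow> real^'n \<Rightarrow> real^'n" where
  "gradient f x = (\<chi> i. partial_deriv f i x)"

lemma gradient_nth [simp]: "gradient f x $ i = partial_deriv f i x"
  by (simp add: gradient_def)

lemma has_derivative_gradient:
  fixes f :: "real^'n \<Rightarrow> real"
  assumes "f differentiable at x"
  shows "(f has_derivative (\<lambda>h. gradient f x \<bullet> h)) (at x)"
proof -
  obtain f' where f': "(f has_derivative f') (at x)"
    using assms unfolding differentiable_def by blast
  have lin: "linear f'" using f' has_derivative_linear by blast
  have "f' h = gradient f x \<bullet> h" for h
  proof -
    have "f' h = f' (\<Sum>i\<in>UNIV. h $ i *\<^sub>R axis i 1)"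
      by (simp add: basis_expansion[where 'a = real, simplified scalar_mult_eq_scaleR])
    also have "\<dots> = (\<Sum>i\<in>UNIV. h $ i * f' (axis i 1))"
      by (simp add: linear_sum[OF lin] linear_scale[OF lin])
    also have "\<dots> = gradient f x \<bullet> h"
      by (simp add: inner_vec_def partial_deriv_eq[OF f'] mult.commute)
    finally show ?thesis .
  qed
  then have "f' = (\<lambda>h. gradient f x \<bullet> h)" by auto
  then show ?thesis using f' by simp
qed

lemma gradient_unique:
  fixes f :: "real^'n \<Rightarrow> real"
  assumes "(f has_derivative (\<lambda>h. g \<bullet> h)) (at x)"
  shows "gradient f x = g"
  by (simp add: vec_eq_iff partial_deriv_eq[OF assms] inner_axis)

lemma real_polynomial_function_imp_differentiable:
  fixes p :: "'a::real_normed_vector \<Rightarrow> real"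
  shows "real_polynomial_function p \<Longrightarrow> p differentiable at x"
proof (induction rule: real_polynomial_function.induct)
  case (linear f) then show ?case
    using bounded_linear_imp_has_derivative differentiable_def by blast
qed auto

lemma real_polynomial_function_imp_continuous_on:
  fixes p :: "'a::real_normed_vector \<Rightarrow> real"
  shows "real_polynomial_function p \<Longrightarrow> continuous_on S p"
  by (meson real_polynomial_function_imp_differentiable continuous_at_imp_continuous_on
      differentiable_imp_continuous_within)

lemma has_derivative_real_polynomial_function:
  fixes p :: "real^'n \<Rightarrow> real"
  assumes "real_polynomial_function p"
  shows "(p has_derivative (\<lambda>h. gradient p x \<bullet> h)) (at x)"
  by (intro has_derivative_gradient real_polynomial_function_imp_differentiable assms)

lemma polynomial_function_vec_nth:
  "polynomial_function G \<Longrightarrow> real_polynomial_function (\<lambda>x. G x $ i)"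
  unfolding polynomial_function_def o_def using bounded_linear_vec_nth by blast

text \<open>\<open>polynomial_function\<close> asks that every bounded linear functional of the map
  be polynomial; each of these is a fixed linear combination of the coordinates.\<close>

lemma polynomial_function_vec_lambda:
  fixes f :: "'n::finite \<Rightarrow> 'a::euclidean_space \<Rightarrow> real"
  assumes "\<And>i. real_polynomial_function (f i)"
  shows "polynomial_function (\<lambda>x. \<chi> i. f i x)"
  unfolding polynomial_function_def o_def
proof (intro allI impI)
  fix \<phi> :: "real^'n \<Rightarrow> real"
  assume "bounded_linear \<phi>"
  then have lin: "linear \<phi>" by (rule bounded_linear.linear)
  have "\<phi> (\<chi> i. f i x) = (\<Sum>i\<in>UNIV. f i x * \<phi> (axis i 1))" for x
  proof -
    have "\<phi> (\<chi> i. f i x) = \<phi> (\<Sum>i\<in>UNIV. f i x *\<^sub>R axis i 1)"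
      using basis_expansion[of "\<chi> i. f i x"] by (simp add: scalar_mult_eq_scaleR)
    then show ?thesis by (simp add: linear_sum[OF lin] linear_scale[OF lin])
  qed
  moreover have "real_polynomial_function (\<lambda>x. \<Sum>i\<in>UNIV. f i x * \<phi> (axis i 1))"
    by (intro real_polynomial_function_sum real_polynomial_function.intros(2,4) assms) auto
  ultimately show "real_polynomial_function (\<lambda>x. \<phi> (\<chi> i. f i x))" by simp
qed

lemma partial_deriv_linear:
  fixes f :: "real^'n \<Rightarrow> real"
  shows "bounded_linear f \<Longrightarrow> partial_deriv f i = (\<lambda>x. f (axis i 1))"
  by (rule ext) (rule partial_deriv_eq[OF bounded_linear_imp_has_derivative])

lemma partial_deriv_const:
  "partial_deriv (\<lambda>x::real^'n. c) i = (\<lambda>x. 0)"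
  by (rule ext) (rule partial_deriv_eq[OF has_derivative_const])

lemma partial_deriv_add:
  fixes f g :: "real^'n \<Rightarrow> real"
  assumes "\<And>x. f differentiable at x" "\<And>x. g differentiable at x"
  shows "partial_deriv (\<lambda>x. f x + g x) i = (\<lambda>x. partial_deriv f i x + partial_deriv g i x)"
  by (rule ext, subst partial_deriv_eq[OF has_derivative_add[OF
        has_derivative_gradient[OF assms(1)] has_derivative_gradient[OF assms(2)]]])
     (simp add: inner_axis)

lemma partial_deriv_mult:
  fixes f g :: "real^'n \<Rightarrow> real"
  assumes "\<And>x. f differentiable at x" "\<And>x. g differentiable at x"
  shows "partial_deriv (\<lambda>x. f x * g x) i
    = (\<lambda>x. f x * partial_deriv g i x + partial_deriv f i x * g x)"
  by (rule ext, subst partial_deriv_eq[OF has_derivative_mult[OF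
        has_derivative_gradient[OF assms(1)] has_derivative_gradient[OF assms(2)]]])
     (simp add: inner_axis)

lemma real_polynomial_function_partial_deriv:
  fixes p :: "real^'n \<Rightarrow> real"
  shows "real_polynomial_function p \<Longrightarrow> real_polynomial_function (partial_deriv p i)"
proof (induction rule: real_polynomial_function.induct)
  case (linear f) then show ?case by (auto simp: partial_deriv_linear)
next
  case (const c) then show ?case by (auto simp: partial_deriv_const)
next
  case (add f g)
  then show ?case
    by (subst partial_deriv_add) (auto intro: real_polynomial_function_imp_differentiable)
next
  case (mult f g)
  then show ?case
    by (subst partial_deriv_mult) (auto intro: real_polynomial_function_imp_differentiable)
qed

text \<open>Schwarz's theorem by induction on polynomial expressions. For a product, the Leibniz
  rule used twice gives four terms: the outer two are symmetric by induction, the inner two change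
  places.\<close>

lemma partial_deriv_commute:
  fixes p :: "real^'n \<Rightarrow> real"
  shows "real_polynomial_function p \<Longrightarrow>
    partial_deriv (partial_deriv p i) j = partial_deriv (partial_deriv p j) i"
proof (induction rule: real_polynomial_function.induct)
  case (linear f) then show ?case by (simp add: partial_deriv_linear partial_deriv_const)
next
  case (const c) then show ?case by (simp add: partial_deriv_const)
next
  case (add f g)
  note d = real_polynomial_function_imp_differentiable real_polynomial_function_partial_deriv
  from add show ?case
    by (simp add: partial_deriv_add d)
next
  case (mult f g)
  note d = real_polynomial_function_imp_differentiable real_polynomial_function_partial_deriv
  from mult.hyps have fg: "\<And>x. f differentiable at x" "\<And>x. g differentiable at x"
    "\<And>k x. partial_deriv f k differentiable at x" "\<And>k x. partial_deriv g k differentiable at x"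
    by (simp_all add: d)
  have "partial_deriv (partial_deriv (\<lambda>x. f x * g x) k) l =
    (\<lambda>x. f x * partial_deriv (partial_deriv g k) l x + partial_deriv f l x * partial_deriv g k x +
      (partial_deriv f k x * partial_deriv g l x + partial_deriv (partial_deriv f k) l x * g x))" for k l
    unfolding partial_deriv_mult[OF fg(1,2)]
    by (subst partial_deriv_add) (simp_all add: fg partial_deriv_mult)
  then show ?case using mult.IH by (simp add: fun_eq_iff)
qed

lemma partial_deriv_prod:
  fixes f :: "'b \<Rightarrow> real^'n \<Rightarrow> real"
  assumes "\<And>i x. i \<in> I \<Longrightarrow> f i differentiable at x"
  shows "partial_deriv (\<lambda>x. \<Prod>i\<in>I. f i x) j
    = (\<lambda>x. \<Sum>l\<in>I. partial_deriv (f l) j x * (\<Prod>i\<in>I - {l}. f i x))"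
proof
  fix x
  have "((\<lambda>x. \<Prod>i\<in>I. f i x) has_derivative
      (\<lambda>h. \<Sum>l\<in>I. (gradient (f l) x \<bullet> h) * (\<Prod>i\<in>I - {l}. f i x))) (at x)"
    by (rule has_derivative_prod) (intro has_derivative_gradient assms)
  then show "partial_deriv (\<lambda>x. \<Prod>i\<in>I. f i x) j x =
      (\<Sum>l\<in>I. partial_deriv (f l) j x * (\<Prod>i\<in>I - {l}. f i x))"
    by (subst partial_deriv_eq, assumption) (simp add: inner_axis)
qed

section \<open>Null Lagrangians\<close>

lemma integral_UNIV_eq:
  fixes f :: "'a::euclidean_space \<Rightarrow> 'b::banach"
  assumes "\<And>x. x \<notin> S \<Longrightarrow> f x = 0"
  shows "integral UNIV f = integral S f"
proof -
  have "f = (\<lambda>x. if x \<in> S then f x else 0)" using assms by auto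
  then show ?thesis by (metis Henstock_Kurzweil_Integration.integral_restrict_UNIV)
qed

lemma integral_UNIV_translate:
  fixes f :: "'a::euclidean_space \<Rightarrow> real"
  assumes "\<And>x. x \<notin> cbox a b \<Longrightarrow> f x = 0"
  shows "integral UNIV (\<lambda>x. f (x + c)) = integral UNIV f"
proof -
  have "integral UNIV (\<lambda>x. f (x + c)) = integral (cbox (a - c) (b - c)) (\<lambda>x. f (x + c))"
    by (rule integral_UNIV_eq) (rule assms, auto simp: mem_box algebra_simps)
  also have "\<dots> = integral (cbox (a - c) (b - c)) (f \<circ> (+) c)"
    by (simp add: o_def add.commute)
  also have "\<dots> = integral (cbox a b) f"
    by (subst integral_shift_cbox_plus) simp
  also have "\<dots> = integral UNIV f"
    by (rule integral_UNIV_eq[symmetric, OF assms])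
  finally show ?thesis .
qed

text \<open>The complement of a closed ball is open, so \<open>h\<close> is locally constant there.
  Support hypotheses can thus be stated for \<open>h\<close> alone.\<close>

lemma gradient_eq_0_outside:
  fixes h :: "real^'n \<Rightarrow> real"
  assumes "\<And>x. (h has_derivative (\<lambda>v. g x \<bullet> v)) (at x)"
    and "\<And>x. x \<notin> cball a \<rho> \<Longrightarrow> h x = 0" and "x \<notin> cball a \<rho>"
  shows "g x = 0"
proof -
  have "((\<lambda>x. 0) has_derivative (\<lambda>v. g x \<bullet> v)) (at x)"
    by (rule has_derivative_transform_within_open[OF assms(1), of "- cball a \<rho>"])
       (use assms(2,3) in \<open>auto simp: open_Compl\<close>)
  then have "g x = gradient (\<lambda>x. 0) x" by (rule gradient_unique[symmetric])
  then show ?thesis by (simp add: vec_eq_iff partial_deriv_const)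
qed

text \<open>Translating \<open>h\<close> does not change its integral; differentiate under the integral sign.\<close>

lemma integral_gradient_eq_0:
  fixes h :: "real^'n \<Rightarrow> real"
  assumes der: "\<And>x. (h has_derivative (\<lambda>v. g x \<bullet> v)) (at x)"
    and cont: "continuous_on UNIV g"
    and supp: "\<And>x. x \<notin> cball a \<rho> \<Longrightarrow> h x = 0"
  shows "integral UNIV (\<lambda>x. g x $ j) = 0"
proof -
  let ?u = "axis j 1 :: real^'n"
  have h_cont: "continuous_on UNIV h"
    using der by (meson continuous_at_imp_continuous_on has_derivative_continuous)
  \<comment> \<open>Shifts of length below 1 keep the support within radius
    \<open>\<rho> + 1\<close>, so one box serves all \<open>s\<close> in \<open>?U\<close>.\<close>
  obtain c where c: "cball a (\<rho> + 1) \<subseteq> cbox (-c) c"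
    using bounded_subset_cbox_symmetric bounded_cball by meson
  have in_c: "x \<in> cbox (-c) c" if "x + s *\<^sub>R ?u \<in> cball a \<rho>" "\<bar>s\<bar> < 1" for x s
  proof -
    have "dist a x \<le> dist a (x + s *\<^sub>R ?u) + dist (x + s *\<^sub>R ?u) x" by (rule dist_triangle)
    also have "\<dots> \<le> \<rho> + 1" using that by (simp add: dist_norm)
    finally show ?thesis using c by auto
  qed
  have c0: "x \<in> cbox (-c) c" if "x \<in> cball a \<rho>" for x using in_c[of x 0] that by simp
  let ?U = "{-1<..<1::real}"
  let ?J = "\<lambda>s. integral (cbox (-c) c) (\<lambda>x. h (x + s *\<^sub>R ?u))"
  have J: "?J s = integral UNIV h" if "s \<in> ?U" for s
  proof -
    have "?J s = integral UNIV (\<lambda>x. h (x + s *\<^sub>R ?u))"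
      by (rule integral_UNIV_eq[symmetric], rule supp) (use in_c that in auto)
    also have "\<dots> = integral UNIV h"
      by (rule integral_UNIV_translate[where a = "-c" and b = c], rule supp) (use c0 in auto)
    finally show ?thesis .
  qed
  have "(?J has_field_derivative integral (cbox (-c) c) (\<lambda>x. g (x + 0 *\<^sub>R ?u) \<bullet> ?u)) (at 0 within ?U)"
  proof (rule leibniz_rule_field_derivative[where fx = "\<lambda>s x. g (x + s *\<^sub>R ?u) \<bullet> ?u"])
    show "((\<lambda>s. h (x + s *\<^sub>R ?u)) has_field_derivative g (x + s *\<^sub>R ?u) \<bullet> ?u) (at s within ?U)" for s x
    proof -
      have "((\<lambda>s. x + s *\<^sub>R ?u) has_derivative (\<lambda>t. t *\<^sub>R ?u)) (at s)"
        by (auto intro!: derivative_eq_intros)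
      from has_derivative_compose[OF this der]
      have "((\<lambda>s. h (x + s *\<^sub>R ?u)) has_derivative (*) (g (x + s *\<^sub>R ?u) \<bullet> ?u)) (at s)"
        by (rule has_derivative_eq_rhs) (simp add: fun_eq_iff)
      then show ?thesis
        unfolding has_field_derivative_def by (rule has_derivative_at_withinI)
    qed
    show "(\<lambda>x. h (x + s *\<^sub>R ?u)) integrable_on cbox (-c) c" for s
      by (rule integrable_continuous)
         (intro continuous_on_compose2[OF h_cont] continuous_intros, auto)
    show "continuous_on (?U \<times> cbox (-c) c) (\<lambda>(s, x). g (x + s *\<^sub>R ?u) \<bullet> ?u)"
      unfolding split_beta
      by (intro continuous_intros continuous_on_compose2[OF cont]) auto
  qed auto
  then have "(?J has_field_derivative integral (cbox (-c) c) (\<lambda>x. g x \<bullet> ?u)) (at 0)"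
    by (simp add: at_within_open[of 0 ?U])
  moreover have "(?J has_field_derivative 0) (at 0)"
    by (rule has_field_derivative_transform_within_open[OF DERIV_const[of "integral UNIV h"], where S = ?U])
       (use J in auto)
  ultimately have "integral (cbox (-c) c) (\<lambda>x. g x \<bullet> ?u) = 0" by (rule DERIV_unique)
  moreover have "integral UNIV (\<lambda>x. g x $ j) = integral (cbox (-c) c) (\<lambda>x. g x $ j)"
    by (rule integral_UNIV_eq) (use gradient_eq_0_outside[OF der supp] c0 in force)
  ultimately show ?thesis by (simp add: inner_axis)
qed

definition jacobian :: "(real^'n \<Rightarrow> real^'n) \<Rightarrow> real^'n \<Rightarrow> real^'n^'n" where
  "jacobian G x = (\<chi> i. gradient (\<lambda>y. G y $ i) x)"

lemma jacobian_nth: "jacobian G x $ i = gradient (\<lambda>y. G y $ i) x"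
  by (simp add: jacobian_def)

text \<open>The Piola identity: the rows of the cofactor matrix of a Jacobian are divergence free.
  In the Leibniz expansion the terms cancel in pairs by symmetry of second derivatives.\<close>

lemma piola_identity:
  fixes G :: "real^'n \<Rightarrow> real^'n"
  assumes G: "polynomial_function G"
  shows "(\<Sum>p | p permutes (UNIV::'n set). of_int (sign p) *
    partial_deriv (\<lambda>x. \<Prod>i\<in>UNIV - {k}. jacobian G x $ i $ p i) (p k) x) = 0"
proof -
  note poly = polynomial_function_vec_nth[OF G]
  define D where "D i = partial_deriv (\<lambda>y. G y $ i)" for i
  define E where "E i j = partial_deriv (D i j)" for i j
  have E_sym: "E i j l = E i l j" for i j l
    unfolding E_def D_def by (rule partial_deriv_commute[OF poly])
  have D_diff: "D i j differentiable at x" for i j x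
    unfolding D_def
    by (intro real_polynomial_function_imp_differentiable real_polynomial_function_partial_deriv poly)
  \<comment> \<open>The part of the term of \<open>p\<close> in which the outer derivative falls on
    the factor of row \<open>l\<close>.\<close>
  define T where "T l p = of_int (sign p) *
    (E l (p l) (p k) x * (\<Prod>i\<in>UNIV - {k} - {l}. D i (p i) x))" for l and p :: "'n \<Rightarrow> 'n"
  let ?P = "{p. p permutes (UNIV::'n set)}"
  have "(\<Sum>p\<in>?P. T l p) = 0" if "l \<noteq> k" for l
  proof -
    \<comment> \<open>Composing with this transposition exchanges the directions \<open>p k\<close>
      and \<open>p l\<close> in \<open>E\<close>, which \<open>E_sym\<close> permits, keeps the
      other factors and flips the sign.\<close>
    let ?q = "Transposition.transpose k l"
    have "T l (p \<circ> ?q) = - T l p" if "p \<in> ?P" for p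
    proof -
      have "permutation p" using that by (auto simp: permutation_permutes)
      then have "sign (p \<circ> ?q) = - sign p"
        using \<open>l \<noteq> k\<close> by (simp add: sign_compose permutation_swap_id sign_swap_id)
      moreover have "(\<Prod>i\<in>UNIV - {k} - {l}. D i ((p \<circ> ?q) i) x) = (\<Prod>i\<in>UNIV - {k} - {l}. D i (p i) x)"
        by (rule prod.cong) auto
      ultimately show ?thesis
        unfolding T_def by (simp add: E_sym[of l "p k"])
    qed
    then have "(\<Sum>p\<in>?P. T l (p \<circ> ?q)) = - (\<Sum>p\<in>?P. T l p)"
      by (simp add: sum_negf)
    moreover have "(\<Sum>p\<in>?P. T l p) = (\<Sum>p\<in>?P. T l (p \<circ> ?q))"
      by (rule sum_permutations_compose_right) (simp add: permutes_swap_id)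
    ultimately show ?thesis by simp
  qed
  then have "(\<Sum>l\<in>UNIV - {k}. \<Sum>p\<in>?P. T l p) = 0" by (simp add: sum.neutral)
  then have "(\<Sum>p\<in>?P. \<Sum>l\<in>UNIV - {k}. T l p) = 0" by (subst sum.swap)
  moreover have "of_int (sign p) *
      partial_deriv (\<lambda>x. \<Prod>i\<in>UNIV - {k}. jacobian G x $ i $ p i) (p k) x = (\<Sum>l\<in>UNIV - {k}. T l p)" for p
  proof -
    have "(\<lambda>x. \<Prod>i\<in>UNIV - {k}. jacobian G x $ i $ p i) = (\<lambda>x. \<Prod>i\<in>UNIV - {k}. D i (p i) x)"
      by (simp add: jacobian_nth D_def)
    then show ?thesis
      by (simp add: partial_deriv_prod D_diff T_def E_def sum_distrib_left)
  qed
  ultimately show ?thesis by simp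
qed

text \<open>Row \<open>k\<close> enters each Leibniz term through a single factor. This displays
  linearity in \<open>v\<close> and isolates the cofactor products to which the Piola identity
  applies.\<close>

lemma det_replace_row:
  fixes A :: "'a::comm_ring_1^'n^'n"
  shows "det (\<chi> i. if i = k then v else A $ i) =
    (\<Sum>p | p permutes (UNIV::'n set). of_int (sign p) * (v $ p k * (\<Prod>i\<in>UNIV - {k}. A $ i $ p i)))"
proof -
  have "(\<Prod>i\<in>UNIV. (\<chi> i. if i = k then v else A $ i) $ i $ p i) =
    v $ p k * (\<Prod>i\<in>UNIV - {k}. A $ i $ p i)" for p
    by (subst prod.remove[of _ k]) (auto intro!: prod.cong)
  then show ?thesis unfolding det_def by simp
qed

text \<open>By the Piola identity the determinant equals the signed sum of the partial derivatives
  of \<open>h * Q p\<close> in direction \<open>p k\<close>, because the terms that differentiate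
  \<open>Q p\<close> cancel. Each of these derivatives has integral zero by compact support.\<close>

lemma integral_det_replace_row_gradient:
  fixes G :: "real^'n \<Rightarrow> real^'n"
  assumes G: "polynomial_function G"
    and der: "\<And>x. (h has_derivative (\<lambda>v. g x \<bullet> v)) (at x)"
    and cont: "continuous_on UNIV g"
    and supp: "\<And>x. x \<notin> cball a \<rho> \<Longrightarrow> h x = 0"
  shows "integral UNIV (\<lambda>x. det (\<chi> i. if i = k then g x else jacobian G x $ i)) = 0"
proof -
  note poly = polynomial_function_vec_nth[OF G]
  let ?P = "{p. p permutes (UNIV::'n set)}"
  define Q where "Q p x = (\<Prod>i\<in>UNIV - {k}. jacobian G x $ i $ p i)" for p and x :: "real^'n"
  \<comment> \<open>The gradient of the product \<open>h * Q p\<close>.\<close>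
  define H where "H p x = Q p x *\<^sub>R g x + h x *\<^sub>R gradient (Q p) x" for p x
  have polyQ: "real_polynomial_function (Q p)" for p
    unfolding Q_def jacobian_nth gradient_nth
    by (intro real_polynomial_function_prod real_polynomial_function_partial_deriv poly) auto
  have h_cont: "continuous_on UNIV h"
    using der by (meson continuous_at_imp_continuous_on has_derivative_continuous)
  have H_der: "((\<lambda>x. h x * Q p x) has_derivative (\<lambda>v. H p x \<bullet> v)) (at x)" for p x
    by (rule has_derivative_eq_rhs[OF has_derivative_mult[OF der
          has_derivative_real_polynomial_function[OF polyQ]]])
       (simp add: H_def fun_eq_iff inner_add_left)
  have H_cont: "continuous_on UNIV (H p)" for p
    unfolding H_def gradient_def
    by (intro continuous_intros cont h_cont real_polynomial_function_imp_continuous_on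
        real_polynomial_function_partial_deriv polyQ)
  have H_int: "integral UNIV (\<lambda>x. H p x $ j) = 0" for p j
    by (rule integral_gradient_eq_0[OF H_der H_cont, where a = a and \<rho> = \<rho>]) (simp add: supp)
  have H_supp: "H p x = 0" if "x \<notin> cball a \<rho>" for p x
    by (rule gradient_eq_0_outside[OF H_der _ that]) (use supp in auto)
  have H_on: "(\<lambda>x. H p x $ j) integrable_on UNIV" for p j
  proof -
    obtain c where c: "cball a \<rho> \<subseteq> cbox (-c) c"
      using bounded_subset_cbox_symmetric bounded_cball by meson
    have "continuous_on (cbox (-c) c) (\<lambda>x. H p x $ j)"
      by (intro continuous_intros continuous_on_subset[OF H_cont]) auto
    then have "(\<lambda>x. H p x $ j) integrable_on cbox (-c) c"
      by (rule integrable_continuous)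
    then show ?thesis
      by (rule integrable_on_superset) (use c H_supp in force)+
  qed
  have "det (\<chi> i. if i = k then g x else jacobian G x $ i) =
    (\<Sum>p\<in>?P. of_int (sign p) * H p x $ p k)" for x
  proof -
    have "(\<Sum>p\<in>?P. of_int (sign p) * H p x $ p k) =
      (\<Sum>p\<in>?P. of_int (sign p) * (g x $ p k * Q p x)) +
      h x * (\<Sum>p\<in>?P. of_int (sign p) * partial_deriv (Q p) (p k) x)"
      by (simp add: H_def algebra_simps sum.distrib sum_distrib_left)
    also have "(\<Sum>p\<in>?P. of_int (sign p) * partial_deriv (Q p) (p k) x) = 0"
      unfolding Q_def by (rule piola_identity[OF G])
    finally show ?thesis by (simp add: det_replace_row Q_def)
  qed
  then have "integral UNIV (\<lambda>x. det (\<chi> i. if i = k then g x else jacobian G x $ i)) =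
    integral UNIV (\<lambda>x. \<Sum>p\<in>?P. of_int (sign p) * H p x $ p k)" by simp
  also have "\<dots> = (\<Sum>p\<in>?P. integral UNIV (\<lambda>x. of_int (sign p) * H p x $ p k))"
    by (rule integral_sum) (auto intro!: integrable_on_mult_right H_on)
  also have "\<dots> = 0" by (simp add: H_int)
  finally show ?thesis .
qed

section \<open>Homotopy invariance of the degree integral\<close>

lemma continuous_on_det:
  fixes A :: "'a::topological_space \<Rightarrow> real^'n^'n"
  assumes "\<And>i j. continuous_on S (\<lambda>x. A x $ i $ j)"
  shows "continuous_on S (\<lambda>x. det (A x))"
  unfolding det_def by (intro continuous_intros assms)

text \<open>Jacobi's formula kept in row form, to match determinants with one replaced row.\<close>

lemma has_field_derivative_det:
  fixes A :: "real \<Rightarrow> real^'n^'n"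
  assumes "\<And>i j. ((\<lambda>t. A t $ i $ j) has_field_derivative A' $ i $ j) (at t)"
  shows "((\<lambda>t. det (A t)) has_field_derivative
    (\<Sum>k\<in>UNIV. det (\<chi> i. if i = k then A' $ k else A t $ i))) (at t)"
proof -
  let ?P = "{p. p permutes (UNIV::'n set)}"
  have "((\<lambda>t. det (A t)) has_field_derivative
    (\<Sum>p\<in>?P. of_int (sign p) * (\<Sum>k\<in>UNIV. A' $ k $ p k * (\<Prod>i\<in>UNIV - {k}. A t $ i $ p i)))) (at t)"
    unfolding det_def
    by (intro DERIV_sum DERIV_cmult has_field_derivative_prod assms)
  also have "(\<Sum>p\<in>?P. of_int (sign p) * (\<Sum>k\<in>UNIV. A' $ k $ p k * (\<Prod>i\<in>UNIV - {k}. A t $ i $ p i))) =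
    (\<Sum>k\<in>UNIV. det (\<chi> i. if i = k then A' $ k else A t $ i))"
    unfolding det_replace_row sum_distrib_left by (rule sum.swap)
  finally show ?thesis .
qed

section \<open>Radial bump functions of class C^1\<close>

lemma has_real_derivative_max_0_power2:
  "((\<lambda>s::real. (max 0 s)\<^sup>2) has_real_derivative 2 * max 0 s) (at s)"
proof (cases s "0::real" rule: linorder_cases)
  case less
  have "((\<lambda>s::real. (max 0 s)\<^sup>2) has_real_derivative 0) (at s)"
    by (rule has_field_derivative_transform_within_open[OF DERIV_const[of 0], where S = "{..<0}"])
       (use less in auto)
  then show ?thesis using less by simp
next
  case greater
  have "((\<lambda>s::real. s\<^sup>2) has_real_derivative 2 * s) (at s)"
    by (auto intro!: derivative_eq_intros)
  then have "((\<lambda>s::real. (max 0 s)\<^sup>2) has_real_derivative 2 * s) (at s)"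
    by (rule has_field_derivative_transform_within_open[where S = "{0<..}"]) (use greater in auto)
  then show ?thesis using greater by simp
next
  case equal
  have "(\<lambda>h::real. (max 0 h)\<^sup>2 / h) \<midarrow>0\<rightarrow> 0"
  proof (rule Lim_null_comparison)
    show "\<forall>\<^sub>F h in at (0::real). norm ((max 0 h)\<^sup>2 / h) \<le> \<bar>h\<bar>"
      by (rule always_eventually) (auto simp: max_def power2_eq_square)
    show "(\<lambda>h::real. \<bar>h\<bar>) \<midarrow>0\<rightarrow> 0" by (auto intro!: tendsto_eq_intros)
  qed
  then show ?thesis using equal by (simp add: DERIV_def)
qed

text \<open>Using the squared norm avoids the singularity of the norm at 0, and squaring the
  positive part removes the corner at the edge of the support.\<close>

definition bump :: "real \<Rightarrow> 'a::real_inner \<Rightarrow> real" where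
  "bump \<delta> y = (max 0 (\<delta>\<^sup>2 - (norm y)\<^sup>2))\<^sup>2"

definition bump_gradient :: "real \<Rightarrow> 'a::real_inner \<Rightarrow> 'a" where
  "bump_gradient \<delta> y = (- 4 * max 0 (\<delta>\<^sup>2 - (norm y)\<^sup>2)) *\<^sub>R y"

lemma has_derivative_bump: "(bump \<delta> has_derivative (\<lambda>v. bump_gradient \<delta> y \<bullet> v)) (at y)"
proof -
  have "((\<lambda>y. \<delta>\<^sup>2 - (norm y)\<^sup>2) has_derivative (\<lambda>v. - 2 * (y \<bullet> v))) (at y)"
    unfolding power2_norm_eq_inner
    by (auto intro!: derivative_eq_intros simp: inner_commute)
  from has_derivative_compose[OF this has_real_derivative_max_0_power2[THEN has_field_derivative_imp_has_derivative]]
  show ?thesis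
    unfolding bump_def[abs_def] bump_gradient_def
    by (rule has_derivative_eq_rhs) (simp add: fun_eq_iff)
qed

lemma bump_eq_0: "0 \<le> \<delta> \<Longrightarrow> \<delta> \<le> norm y \<Longrightarrow> bump \<delta> y = 0"
  and bump_gradient_eq_0: "0 \<le> \<delta> \<Longrightarrow> \<delta> \<le> norm y \<Longrightarrow> bump_gradient \<delta> y = 0"
  by (auto simp: bump_def bump_gradient_def max_def power_mono)

lemma continuous_on_bump [continuous_intros]:
  "continuous_on S f \<Longrightarrow> continuous_on S (\<lambda>x. bump \<delta> (f x))"
  unfolding bump_def by (intro continuous_intros)

lemma continuous_on_bump_gradient [continuous_intros]:
  "continuous_on S f \<Longrightarrow> continuous_on S (\<lambda>x. bump_gradient \<delta> (f x))"
  unfolding bump_gradient_def by (intro continuous_intros)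

text \<open>If all zeros of \<open>G\<close> in \<open>S\<close> are interior and \<open>\<delta>\<close> is small, this is the Brouwer degree of \<open>G\<close> on \<open>S\<close>
  times the integral of the bump function.\<close>

definition degree_integral :: "real \<Rightarrow> (real^'n \<Rightarrow> real^'n) \<Rightarrow> (real^'n) set \<Rightarrow> real" where
  "degree_integral \<delta> G S = integral S (\<lambda>x. bump \<delta> (G x) * det (jacobian G x))"

lemma continuous_on_gradient_polynomial:
  fixes p :: "real^'n \<Rightarrow> real"
  assumes "real_polynomial_function p"
  shows "continuous_on S (gradient p)"
  unfolding gradient_def
  by (intro continuous_intros real_polynomial_function_imp_continuous_on
      real_polynomial_function_partial_deriv assms)

lemma has_derivative_jacobian:
  fixes G :: "real^'n \<Rightarrow> real^'n"
  assumes "polynomial_function G"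
  shows "(G has_derivative (\<lambda>v. jacobian G x *v v)) (at x)"
proof (subst has_derivative_componentwise_within, intro ballI)
  fix b :: "real^'n" assume "b \<in> Basis"
  then obtain i where "b = axis i 1" by (auto simp: Basis_vec_def)
  then show "((\<lambda>x. G x \<bullet> b) has_derivative (\<lambda>v. (jacobian G x *v v) \<bullet> b)) (at x)"
    using has_derivative_real_polynomial_function[OF polynomial_function_vec_nth[OF assms, of i]]
    by (simp add: inner_axis matrix_vector_mul_component jacobian_nth)
qed

text \<open>The \<open>t\<close>-derivative of the integrand is a sum of determinants with row
  \<open>k\<close> replaced by the gradient of \<open>bump \<delta> (G t x) * V x $ k\<close>.
  Having the bound on an annulus rather than on a sphere makes these functions vanish near the
  boundary, so extension by zero keeps them C^1 and their integrals are zero.\<close>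

lemma degree_integral_homotopy:
  fixes P Q :: "real^'n \<Rightarrow> real^'n"
  assumes polyP: "polynomial_function P" and polyQ: "polynomial_function Q"
    and "\<sigma> < \<rho>" "0 \<le> \<delta>"
    and far: "\<And>t x. \<lbrakk>0 \<le> t; t \<le> 1; \<sigma> < dist a x; dist a x < \<rho>\<rbrakk> \<Longrightarrow>
      \<delta> \<le> norm ((1 - t) *\<^sub>R P x + t *\<^sub>R Q x)"
  shows "degree_integral \<delta> P (ball a \<rho>) = degree_integral \<delta> Q (ball a \<rho>)"
proof -
  define V where "V x = Q x - P x" for x
  define G where "G t x = P x + t *\<^sub>R V x" for t x
  have polyV: "polynomial_function V"
    unfolding V_def using polyP polyQ by auto
  have polyG: "polynomial_function (G t)" for t
    unfolding G_def using polyP polyV by auto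
  note nth = polynomial_function_vec_nth
  have P_cont: "continuous_on UNIV P" and V_cont: "continuous_on UNIV V"
    by (auto intro: continuous_on_polymonial_function polyP polyV)
  have annulus: "\<delta> \<le> norm (G t x)" if "t \<in> {0..1}" "\<sigma> < dist a x" "dist a x < \<rho>" for t x
  proof -
    have "G t x = (1 - t) *\<^sub>R P x + t *\<^sub>R Q x" by (simp add: G_def V_def algebra_simps)
    then show ?thesis using far[of t x] that by simp
  qed
  define gP where "gP i = gradient (\<lambda>x. P x $ i)" for i
  define gV where "gV i = gradient (\<lambda>x. V x $ i)" for i
  have gP_cont: "continuous_on UNIV (gP i)" and gV_cont: "continuous_on UNIV (gV i)" for i
    unfolding gP_def gV_def
    by (intro continuous_on_gradient_polynomial nth polyP polyV)+
  have der: "((\<lambda>x. P x $ i) has_derivative (\<lambda>v. gP i x \<bullet> v)) (at x)"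
    "((\<lambda>x. V x $ i) has_derivative (\<lambda>v. gV i x \<bullet> v)) (at x)"
    "((\<lambda>x. G t x $ i) has_derivative (\<lambda>v. jacobian (G t) x $ i \<bullet> v)) (at x)" for i t x
    unfolding gP_def gV_def jacobian_nth
    by (intro has_derivative_real_polynomial_function nth polyP polyV polyG)+
  have jac: "jacobian (G t) x $ i = gP i x + t *\<^sub>R gV i x" for t x i
  proof -
    have "((\<lambda>x. P x $ i + t * V x $ i) has_derivative (\<lambda>v. (gP i x + t *\<^sub>R gV i x) \<bullet> v)) (at x)"
      by (auto intro!: derivative_eq_intros der simp: inner_add_left)
    then have "gradient (\<lambda>x. P x $ i + t * V x $ i) x = gP i x + t *\<^sub>R gV i x"
      by (rule gradient_unique)
    then show ?thesis by (simp add: jacobian_nth G_def)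
  qed
  note G_der = has_derivative_jacobian[OF polyG]

  \<comment> \<open>\<open>f'\<close> is the derivative of \<open>f\<close> in \<open>t\<close>, and
    \<open>w k t\<close> is the gradient in \<open>x\<close> of
    \<open>bump \<delta> (G t x) * V x $ k\<close>; \<open>V\<close> is the velocity of the
    homotopy.\<close>
  define f where "f t x = bump \<delta> (G t x) * det (jacobian (G t) x)" for t x
  define f' where "f' t x = bump_gradient \<delta> (G t x) \<bullet> V x * det (jacobian (G t) x) +
    bump \<delta> (G t x) * (\<Sum>k\<in>UNIV. det (\<chi> i. if i = k then gV k x else jacobian (G t) x $ i))" for t x
  define w where "w k t x = bump \<delta> (G t x) *\<^sub>R gV k x +
    V x $ k *\<^sub>R (\<Sum>l\<in>UNIV. bump_gradient \<delta> (G t x) $ l *\<^sub>R jacobian (G t) x $ l)" for k t x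

  have f_der: "((\<lambda>t. f t x) has_field_derivative f' t x) (at t)" for t x
  proof -
    have "((\<lambda>t. G t x) has_derivative (\<lambda>s. s *\<^sub>R V x)) (at t)"
      unfolding G_def by (auto intro!: derivative_eq_intros)
    from has_derivative_compose[OF this has_derivative_bump]
    have "((\<lambda>t. bump \<delta> (G t x)) has_field_derivative bump_gradient \<delta> (G t x) \<bullet> V x) (at t)"
      unfolding has_field_derivative_def
      by (rule has_derivative_eq_rhs) (simp add: fun_eq_iff)
    moreover have "((\<lambda>t. det (jacobian (G t) x)) has_field_derivative
        (\<Sum>k\<in>UNIV. det (\<chi> i. if i = k then (\<chi> k. gV k x) $ k else jacobian (G t) x $ i))) (at t)"
      by (rule has_field_derivative_det) (auto simp: jac intro!: derivative_eq_intros)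
    ultimately show ?thesis
      unfolding f_def f'_def vec_lambda_beta by (auto intro!: derivative_eq_intros)
  qed
  have w_der: "((\<lambda>x. bump \<delta> (G t x) * V x $ k) has_derivative (\<lambda>v. w k t x \<bullet> v)) (at x)" for k t x
  proof -
    have "(\<Sum>l\<in>UNIV. bump_gradient \<delta> (G t x) $ l *\<^sub>R jacobian (G t) x $ l) \<bullet> v =
      bump_gradient \<delta> (G t x) \<bullet> (jacobian (G t) x *v v)" for v
      by (simp add: inner_sum_left inner_vec_def[of "bump_gradient \<delta> (G t x)"]
          matrix_vector_mul_component)
    then show ?thesis
      by (intro has_derivative_eq_rhs[OF has_derivative_mult[OF
            has_derivative_compose[OF G_der has_derivative_bump] der(2)]])
         (simp add: fun_eq_iff w_def inner_add_left)
  qed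
  \<comment> \<open>The sum over \<open>l\<close> in \<open>w\<close> combines rows of the Jacobian.
    Replacing row \<open>k\<close> by it leaves only the coefficient of row \<open>k\<close>
    (Cramer), and summing over \<open>k\<close> rebuilds the inner product of the bump gradient with
    \<open>V\<close>.\<close>
  have f'_eq: "f' t x = (\<Sum>k\<in>UNIV. det (\<chi> i. if i = k then w k t x else jacobian (G t) x $ i))" for t x
  proof -
    let ?J = "jacobian (G t) x" and ?b = "bump_gradient \<delta> (G t x)"
    have "det (\<chi> i. if i = k then w k t x else ?J $ i) =
      bump \<delta> (G t x) * det (\<chi> i. if i = k then gV k x else ?J $ i) + V x $ k * (?b $ k * det ?J)" for k
    proof -
      let ?s = "\<Sum>l\<in>UNIV. ?b $ l *\<^sub>R ?J $ l"
      have "det (\<chi> i. if i = k then w k t x else ?J $ i) =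
        bump \<delta> (G t x) * det (\<chi> i. if i = k then gV k x else ?J $ i) +
        V x $ k * det (\<chi> i. if i = k then ?s else ?J $ i)"
        unfolding w_def det_replace_row sum_distrib_left sum.distrib[symmetric]
        by (rule sum.cong) (simp_all add: algebra_simps)
      also have "det (\<chi> i. if i = k then ?s else ?J $ i) = ?b $ k * det ?J"
        using cramer_lemma_transpose[where x = ?b and A = ?J and k = k]
        unfolding row_def scalar_mult_eq_scaleR vec_lambda_eta .
      finally show ?thesis .
    qed
    then show ?thesis
      unfolding f'_def by (simp add: sum.distrib inner_vec_def sum_distrib_left sum_distrib_right
          algebra_simps)
  qed

  \<comment> \<open>A continuous weight, 1 up to radius \<open>\<sigma>\<close> and 0 from radius
    \<open>\<rho>\<close> on. On functions vanishing in the open annulus it acts as the indicator of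
    the ball, yet it keeps integrands continuous on a box, as the Leibniz rule requires.\<close>
  define cut where "cut x = max 0 (min 1 ((\<rho> - dist a x) / (\<rho> - \<sigma>)))" for x
  have cut: "(if x \<in> ball a \<rho> then u x else 0) = cut x *\<^sub>R u x"
    if "\<sigma> < dist a x \<Longrightarrow> dist a x < \<rho> \<Longrightarrow> u x = 0" for x and u :: "real^'n \<Rightarrow> 'b::real_vector"
  proof -
    consider "dist a x \<le> \<sigma>" | "\<sigma> < dist a x" "dist a x < \<rho>" | "dist a x \<ge> \<rho>" by linarith
    then show ?thesis
    proof cases
      case 1
      then have "cut x = 1" using \<open>\<sigma> < \<rho>\<close> by (simp add: cut_def)
      then show ?thesis using 1 \<open>\<sigma> < \<rho>\<close> by simp
    next
      case 2
      then show ?thesis using that by simp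
    next
      case 3
      then have "cut x = 0" using \<open>\<sigma> < \<rho>\<close> by (simp add: cut_def divide_le_0_iff)
      then show ?thesis using 3 by simp
    qed
  qed
  have cut_cont: "continuous_on S cut" for S
    unfolding cut_def using \<open>\<sigma> < \<rho>\<close> by (intro continuous_intros) auto

  have f'_int: "integral UNIV (\<lambda>x. if x \<in> ball a \<rho> then f' t x else 0) = 0" if t: "t \<in> {0..1}" for t
  proof -
    have w0: "w k t x = 0" if "\<sigma> < dist a x" "dist a x < \<rho>" for k x
      using annulus[OF t that] \<open>0 \<le> \<delta>\<close> by (simp add: w_def bump_eq_0 bump_gradient_eq_0)
    define u where "u k x = (if x \<in> ball a \<rho> then w k t x else 0)" for k x
    define h where "h k x = (if x \<in> ball a \<rho> then bump \<delta> (G t x) * V x $ k else 0)" for k x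
    have u_cont: "continuous_on UNIV (u k)" for k
    proof -
      have "u k = (\<lambda>x. cut x *\<^sub>R w k t x)"
        unfolding u_def by (rule ext) (rule cut, rule w0)
      moreover have "continuous_on UNIV (\<lambda>x. cut x *\<^sub>R w k t x)"
        unfolding w_def jac G_def
        by (intro continuous_intros cut_cont P_cont V_cont gP_cont gV_cont)
      ultimately show ?thesis by simp
    qed
    have h_der: "(h k has_derivative (\<lambda>v. u k x \<bullet> v)) (at x)" for k x
    proof (cases "dist a x < \<rho>")
      case True
      have "(h k has_derivative (\<lambda>v. w k t x \<bullet> v)) (at x)"
        by (rule has_derivative_transform_within_open[OF w_der, of "ball a \<rho>"])
           (use True in \<open>auto simp: h_def\<close>)
      then show ?thesis using True by (simp add: u_def)
    next
      case False
      \<comment> \<open>A point off the open ball has a neighbourhood outside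
        \<open>cball a \<sigma>\<close>; there \<open>h k\<close> vanishes, either by definition or
        by the annulus bound.\<close>
      have "h k y = 0" if "\<sigma> < dist a y" for y
        using annulus[OF t that] \<open>0 \<le> \<delta>\<close> by (simp add: h_def bump_eq_0)
      then have "(h k has_derivative (\<lambda>v. 0)) (at x)"
        by (intro has_derivative_transform_within_open[OF has_derivative_const[of 0], of "- cball a \<sigma>"])
           (use False \<open>\<sigma> < \<rho>\<close> in \<open>auto simp: open_Compl\<close>)
      then show ?thesis using False by (simp add: u_def)
    qed
    have int0: "integral UNIV (\<lambda>x. det (\<chi> i. if i = k then u k x else jacobian (G t) x $ i)) = 0" for k
      by (rule integral_det_replace_row_gradient[OF polyG h_der u_cont, where a = a and \<rho> = \<rho>])
         (simp add: h_def)
    have on: "(\<lambda>x. det (\<chi> i. if i = k then u k x else jacobian (G t) x $ i)) integrable_on UNIV" for k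
    proof -
      obtain c where c: "cball a \<rho> \<subseteq> cbox (-c) c"
        using bounded_subset_cbox_symmetric bounded_cball by meson
      have ent: "continuous_on (cbox (-c) c) (\<lambda>x. (\<chi> i. if i = k then u k x else jacobian (G t) x $ i) $ i $ j)" for i j
        by (cases "i = k")
           (auto simp: jac intro!: continuous_intros continuous_on_subset[OF u_cont]
             continuous_on_subset[OF gP_cont] continuous_on_subset[OF gV_cont])
      have "(\<lambda>x. det (\<chi> i. if i = k then u k x else jacobian (G t) x $ i)) integrable_on cbox (-c) c"
        by (intro integrable_continuous continuous_on_det ent)
      then show ?thesis
      proof (rule integrable_on_superset)
        fix x assume "x \<notin> cbox (-c) c"
        then have "x \<notin> cball a \<rho>" using c by blast
        then have "u k x = 0" by (simp add: u_def)
        then show "det (\<chi> i. if i = k then u k x else jacobian (G t) x $ i) = 0"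
          by (simp add: det_replace_row)
      qed auto
    qed
    have "(\<lambda>x. if x \<in> ball a \<rho> then f' t x else 0) =
      (\<lambda>x. \<Sum>k\<in>UNIV. det (\<chi> i. if i = k then u k x else jacobian (G t) x $ i))"
      by (rule ext) (simp add: f'_eq u_def det_replace_row)
    then show ?thesis by (simp add: integral_sum on int0)
  qed

  obtain c where c: "cball a \<rho> \<subseteq> cbox (-c) c"
    using bounded_subset_cbox_symmetric bounded_cball by meson
  have box: "integral (cbox (-c) c) (\<lambda>x. cut x * u x) = integral UNIV (\<lambda>x. if x \<in> ball a \<rho> then u x else 0)"
    if "\<And>x. \<sigma> < dist a x \<Longrightarrow> dist a x < \<rho> \<Longrightarrow> u x = 0" for u :: "real^'n \<Rightarrow> real"
  proof -
    have "(\<lambda>x. cut x * u x) = (\<lambda>x. if x \<in> ball a \<rho> then u x else 0)"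
      using cut[of _ u] that by fastforce
    moreover have "integral UNIV (\<lambda>x. if x \<in> ball a \<rho> then u x else 0) =
      integral (cbox (-c) c) (\<lambda>x. if x \<in> ball a \<rho> then u x else 0)"
      by (rule integral_UNIV_eq) (metis (no_types) c ball_subset_cball subsetD)
    ultimately show ?thesis by simp
  qed
  let ?I = "\<lambda>t. integral (cbox (-c) c) (\<lambda>x. cut x * f t x)"
  have I: "?I t = degree_integral \<delta> (G t) (ball a \<rho>)" if "t \<in> {0..1}" for t
  proof -
    have "?I t = integral UNIV (\<lambda>x. if x \<in> ball a \<rho> then f t x else 0)"
      using annulus[OF that] \<open>0 \<le> \<delta>\<close> by (intro box) (simp add: f_def bump_eq_0)
    then show ?thesis
      unfolding Henstock_Kurzweil_Integration.integral_restrict_UNIV degree_integral_def f_def .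
  qed
  have "(?I has_field_derivative 0) (at t within {0..1})" if t: "t \<in> {0..1}" for t
  proof -
    have "(?I has_field_derivative integral (cbox (-c) c) (\<lambda>x. cut x * f' t x)) (at t within {0..1})"
    proof (rule leibniz_rule_field_derivative[where fx = "\<lambda>t x. cut x * f' t x"])
      show "((\<lambda>t. cut x * f t x) has_field_derivative cut x * f' t x) (at t within {0..1})" for t x
        by (intro DERIV_cmult has_field_derivative_at_within[OF f_der])
      show "(\<lambda>x. cut x * f t x) integrable_on cbox (-c) c" for t
        unfolding f_def
        by (intro integrable_continuous continuous_on_mult cut_cont continuous_on_bump
            continuous_on_polymonial_function[OF polyG] continuous_on_det)
           (auto simp: jac intro!: continuous_intros continuous_on_subset[OF gP_cont]
            continuous_on_subset[OF gV_cont])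
      have ent: "continuous_on S (\<lambda>z. (\<chi> i. if i = k then gV k (snd z) else jacobian (G (fst z)) (snd z) $ i) $ i $ j)"
        for S :: "(real \<times> (real^'n)) set" and i j k
        by (cases "i = k")
           (auto simp: jac intro!: continuous_intros continuous_on_compose2[OF gP_cont]
             continuous_on_compose2[OF gV_cont])
      have ent': "continuous_on S (\<lambda>z. jacobian (G (fst z)) (snd z) $ i $ j)"
        for S :: "(real \<times> (real^'n)) set" and i j
        by (auto simp: jac intro!: continuous_intros continuous_on_compose2[OF gP_cont]
             continuous_on_compose2[OF gV_cont])
      show "continuous_on ({0..1} \<times> cbox (-c) c) (\<lambda>(t, x). cut x * f' t x)"
        unfolding split_beta f'_def
        by (intro continuous_intros continuous_on_det ent ent' continuous_on_compose2[OF cut_cont])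
           (auto simp: G_def intro!: continuous_intros continuous_on_compose2[OF P_cont]
             continuous_on_compose2[OF V_cont])
    qed (use t in auto)
    also have "integral (cbox (-c) c) (\<lambda>x. cut x * f' t x) = 0"
      using annulus[OF t] \<open>0 \<le> \<delta>\<close> f'_int[OF t]
      by (subst box) (simp_all add: f'_def bump_eq_0 bump_gradient_eq_0)
    finally show ?thesis .
  qed
  then obtain k where "\<forall>t\<in>{0..1}. ?I t = k"
    using has_field_derivative_zero_constant[of "{0..1}" ?I] by auto
  then have "degree_integral \<delta> (G 0) (ball a \<rho>) = degree_integral \<delta> (G 1) (ball a \<rho>)"
    using I[of 0] I[of 1] by force
  moreover have "G 0 = P" "G 1 = Q" by (auto simp: G_def V_def)
  ultimately show ?thesis by simp
qed

section \<open>Spectral theorem and negativity index\<close>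

lemma symmetric_matrix_inner:
  fixes A :: "real^'n^'n"
  assumes "transpose A = A"
  shows "x \<bullet> (A *v y) = (A *v x) \<bullet> y"
  by (metis assms dot_lmul_matrix vector_transpose_matrix)

text \<open>The Rayleigh quotient attains its maximum on the unit sphere of \<open>S\<close> at an eigenvector.\<close>

lemma symmetric_matrix_eigenvector_exists:
  fixes A :: "real^'n^'n"
  assumes sym: "transpose A = A" and S: "subspace S" "S \<noteq> {0}"
    and inv: "\<And>x. x \<in> S \<Longrightarrow> A *v x \<in> S"
  obtains v c where "v \<in> S" "norm v = 1" "A *v v = c *\<^sub>R v"
proof -
  let ?K = "S \<inter> sphere 0 1"
  have "compact ?K"
    by (intro closed_Int_compact closed_subspace S compact_sphere)
  moreover have "?K \<noteq> {}"
  proof -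
    obtain x where "x \<in> S" "x \<noteq> 0" using S subspace_0 by blast
    then have "x /\<^sub>R norm x \<in> ?K" using S by (simp add: subspace_scale)
    then show ?thesis by blast
  qed
  moreover have "continuous_on ?K (\<lambda>x. x \<bullet> (A *v x))"
    by (intro continuous_intros)
  ultimately obtain v where v: "v \<in> ?K" and max: "\<And>x. x \<in> ?K \<Longrightarrow> x \<bullet> (A *v x) \<le> v \<bullet> (A *v v)"
    using continuous_attains_sup[of ?K "\<lambda>x. x \<bullet> (A *v x)"] by blast
  define c where "c = v \<bullet> (A *v v)"
  \<comment> \<open>Maximality means that \<open>q\<close> is nonpositive on \<open>S\<close>, with
    value 0 at \<open>v\<close>. The vector \<open>u\<close> is the residual that has to
    vanish.\<close>
  define q where "q x = x \<bullet> (A *v x) - c * (x \<bullet> x)" for x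
  define u where "u = A *v v - c *\<^sub>R v"
  have vS: "v \<in> S" and vn: "norm v = 1" using v by auto
  then have vv: "v \<bullet> v = 1" by (simp add: norm_eq_1)
  have uS: "u \<in> S" unfolding u_def using vS inv S by (simp add: subspace_diff subspace_scale)
  have q_nonpos: "q x \<le> 0" if "x \<in> S" for x
  proof (cases "x = 0")
    case False
    have "x /\<^sub>R norm x \<in> ?K" using that S False by (simp add: subspace_scale)
    from max[OF this] have "(x \<bullet> (A *v x)) / (norm x)\<^sup>2 \<le> c"
      by (simp add: c_def matrix_vector_mult_scaleR power2_eq_square divide_inverse mult_ac)
    then show ?thesis
      using False by (simp add: q_def divide_simps power2_norm_eq_inner mult.commute)
  qed (simp add: q_def)
  have expand: "q (v + t *\<^sub>R u) = 2 * t * (u \<bullet> u) + t\<^sup>2 * q u" for t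
  proof -
    have "q (v + t *\<^sub>R u) = q v + 2 * t * (u \<bullet> (A *v v) - c * (u \<bullet> v)) + t\<^sup>2 * q u"
      using symmetric_matrix_inner[OF sym, of v u]
      by (simp add: q_def matrix_vector_mult_scaleR matrix_vector_right_distrib inner_add_left
          inner_add_right inner_commute power2_eq_square algebra_simps)
    moreover have "q v = 0" by (simp add: q_def c_def vv)
    moreover have "u \<bullet> (A *v v) - c * (u \<bullet> v) = u \<bullet> u"
      by (simp add: u_def inner_diff_right)
    ultimately show ?thesis by simp
  qed
  have "u \<bullet> u = 0"
  proof (rule ccontr)
    assume "u \<bullet> u \<noteq> 0"
    then have pos: "u \<bullet> u > 0" by (simp add: inner_gt_zero_iff)
    \<comment> \<open>Small enough that \<open>t * \<bar>q u\<bar>\<close> is at most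
      \<open>u \<bullet> u\<close>: the linear term in \<open>expand\<close> then dominates and
      would make \<open>q\<close> positive at a point of \<open>S\<close>.\<close>
    define t where "t = (u \<bullet> u) / (\<bar>q u\<bar> + 1)"
    have t: "t > 0" unfolding t_def using pos by (simp add: divide_pos_pos)
    have "2 * t * (u \<bullet> u) + t\<^sup>2 * q u \<le> 0"
      using q_nonpos[of "v + t *\<^sub>R u"] vS uS S expand by (simp add: subspace_add subspace_scale)
    then have "t * (2 * (u \<bullet> u) + t * q u) \<le> 0" by (simp add: power2_eq_square algebra_simps)
    then have "2 * (u \<bullet> u) + t * q u \<le> 0" using t by (simp add: mult_le_0_iff)
    moreover have "t * \<bar>q u\<bar> \<le> u \<bullet> u"
      using pos by (simp add: t_def field_simps)
    moreover have "t * q u \<ge> - (t * \<bar>q u\<bar>)"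
      using t by (simp add: abs_if mult_le_0_iff)
    ultimately show False using pos by linarith
  qed
  then have "A *v v = c *\<^sub>R v" by (simp add: u_def)
  with vS vn show ?thesis by (rule that)
qed

definition diagonal_matrix :: "('n \<Rightarrow> 'a::zero) \<Rightarrow> 'a^'n^'n" where
  "diagonal_matrix l = (\<chi> i j. if i = j then l i else 0)"

lemma diagonal_matrix_vector_mult [simp]:
  fixes x :: "'a::semiring_1^'n"
  shows "(diagonal_matrix l *v x) $ i = l i * x $ i"
proof -
  have "(diagonal_matrix l *v x) $ i = (\<Sum>j\<in>UNIV. if i = j then l i * x $ j else 0)"
    unfolding diagonal_matrix_def matrix_vector_mult_def vec_lambda_beta by (rule sum.cong) auto
  then show ?thesis by simp
qed

text \<open>Orthonormal sets of eigenvectors grow one vector at a time: by symmetry their orthogonal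
  complement is invariant, and it is nonzero while fewer than \<open>CARD('n)\<close> vectors are
  chosen. The final set supplies the rows of \<open>Q\<close>.\<close>

theorem spectral_theorem_real:
  fixes A :: "real^'n^'n"
  assumes sym: "transpose A = A"
  obtains Q l where "orthogonal_matrix Q" "Q ** A ** transpose Q = diagonal_matrix l"
proof -
  let ?good = "\<lambda>B. pairwise orthogonal B \<and> (\<forall>b\<in>B. norm b = 1 \<and> (\<exists>c. A *v b = c *\<^sub>R b))"
  have "\<exists>B. finite B \<and> card B = k \<and> ?good B" if "k \<le> CARD('n)" for k
    using that
  proof (induction k)
    case 0
    then show ?case by (intro exI[of _ "{}"]) auto
  next
    case (Suc k)
    then obtain B where B: "finite B" "card B = k" "?good B" by auto
    define S where "S = {x. \<forall>b\<in>B. b \<bullet> x = 0}"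
    have "dim B < DIM(real^'n)"
      using B Suc.prems dim_le_card'[of B] by simp
    then obtain a where "a \<noteq> 0" "span B \<subseteq> {x. a \<bullet> x = 0}"
      using lowdim_subset_hyperplane by blast
    then have "a \<in> S" "a \<noteq> 0" by (auto simp: S_def inner_commute dest: subsetD[OF _ span_base])
    then have S0: "S \<noteq> {0}" by blast
    have S_sub: "subspace S"
      by (auto simp: S_def subspace_def inner_add_right)
    have "A *v x \<in> S" if "x \<in> S" for x
      unfolding S_def
    proof (intro CollectI ballI)
      fix b assume "b \<in> B"
      then obtain c where "A *v b = c *\<^sub>R b" using B by blast
      then show "b \<bullet> (A *v x) = 0"
        using that \<open>b \<in> B\<close> by (simp add: symmetric_matrix_inner[OF sym] S_def)
    qed
    then obtain v c where v: "v \<in> S" "norm v = 1" "A *v v = c *\<^sub>R v"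
      by (rule symmetric_matrix_eigenvector_exists[OF sym S_sub S0]) auto
    have orth: "b \<bullet> v = 0" if "b \<in> B" for b using v that by (simp add: S_def)
    have "v \<notin> B" using orth[of v] v by (auto simp: norm_eq_1)
    moreover have "?good (insert v B)"
      using B v orth by (auto simp: pairwise_insert orthogonal_def inner_commute)
    ultimately show ?case using B by (intro exI[of _ "insert v B"]) simp
  qed
  then obtain B where B: "finite B" "card B = CARD('n)" "?good B" by blast
  then obtain f where f: "bij_betw f (UNIV::'n set) B"
    by (metis finite_class.finite_UNIV finite_same_card_bij)
  have fB: "f i \<in> B" for i using f bij_betwE by blast
  have f_inner: "f i \<bullet> f j = (if i = j then 1 else 0)" for i j
  proof (cases "i = j")
    case True
    then show ?thesis using B fB by (metis norm_eq_1)
  next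
    case False
    then have "f i \<noteq> f j" using f by (simp add: bij_betw_def inj_eq)
    then show ?thesis using False B fB by (simp add: pairwise_def orthogonal_def)
  qed
  have "\<forall>i. \<exists>c. A *v f i = c *\<^sub>R f i" using B fB by blast
  from choice[OF this] obtain l where l: "\<And>i. A *v f i = l i *\<^sub>R f i" by blast
  define Q where "Q = (\<chi> i. f i)"
  \<comment> \<open>Stated for arbitrary \<open>M\<close> since it is used twice:
    \<open>mat 1\<close> gives orthogonality of \<open>Q\<close>, and \<open>A\<close> gives the
    diagonal form.\<close>
  have QM: "(Q ** M ** transpose Q) $ i $ j = f i \<bullet> (M *v f j)" for M i j
    by (simp add: Q_def matrix_matrix_mult_def transpose_def inner_vec_def matrix_vector_mult_def
        sum_distrib_left sum_distrib_right mult_ac) (rule sum.swap)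
  have "Q ** transpose Q = mat 1"
  proof -
    have "(Q ** transpose Q) $ i $ j = f i \<bullet> f j" for i j
      using QM[of "mat 1" i j] by simp
    then show ?thesis by (simp add: vec_eq_iff f_inner) (simp add: mat_def)
  qed
  then have "orthogonal_matrix Q"
    by (metis orthogonal_matrix orthogonal_matrix_transpose transpose_transpose)
  moreover have "Q ** A ** transpose Q = diagonal_matrix l"
    by (simp add: vec_eq_iff QM l f_inner diagonal_matrix_def)
  ultimately show ?thesis by (rule that)
qed

section \<open>Quadratic form, determinant and index read off from an orthogonal
  diagonalization\<close>

context
  fixes A Q :: "real^'n^'n" and l :: "'n \<Rightarrow> real"
  assumes Q: "orthogonal_matrix Q" and diag: "Q ** A ** transpose Q = diagonal_matrix l"
begin

lemma diagonalization_inner: "x \<bullet> (A *v x) = (\<Sum>i\<in>UNIV. l i * ((Q *v x) $ i)\<^sup>2)"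
proof -
  have "transpose Q *v (Q *v x) = x"
    using Q by (simp add: orthogonal_matrix matrix_vector_mul_assoc del: transpose_matrix_vector)
  then have "(Q *v x) \<bullet> ((Q ** A ** transpose Q) *v (Q *v x)) = (Q *v x) \<bullet> (Q *v (A *v x))"
    by (simp flip: matrix_vector_mul_assoc del: transpose_matrix_vector)
  also have "\<dots> = x \<bullet> (A *v x)"
    using Q by (metis orthogonal_transformation_def orthogonal_transformation_matrix
        matrix_of_matrix_vector_mul matrix_vector_mul_linear)
  finally show ?thesis
    unfolding diag inner_vec_def[of "Q *v x"] by (simp add: power2_eq_square mult_ac)
qed

lemma diagonalization_eigenvectors:
  obtains e where "\<And>i j. e i \<bullet> e j = (if i = j then 1 else 0)" "\<And>i. e i \<bullet> (A *v e i) = l i"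
proof
  let ?e = "\<lambda>i. transpose Q *v axis i 1 :: real^'n"
  have Qe: "Q *v ?e i = axis i 1" for i
    using Q by (simp add: orthogonal_matrix_def matrix_vector_mul_assoc del: transpose_matrix_vector)
  show "?e i \<bullet> ?e j = (if i = j then 1 else 0)" for i j
  proof -
    have "?e i \<bullet> ?e j = axis i 1 \<bullet> (Q *v ?e j)" by (simp add: dot_lmul_matrix)
    then show ?thesis unfolding Qe by (simp only: inner_axis_axis) simp
  qed
  show "?e i \<bullet> (A *v ?e i) = l i" for i
  proof -
    have "?e i \<bullet> (A *v ?e i) = (\<Sum>j\<in>UNIV. l j * (axis i 1 $ j)\<^sup>2)"
      unfolding diagonalization_inner Qe ..
    also have "\<dots> = (\<Sum>j\<in>UNIV. if j = i then l i else 0)"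
      by (rule sum.cong) (auto simp: axis_def)
    finally show ?thesis by simp
  qed
qed

lemma det_diagonalization_shift: "det (a *\<^sub>R mat 1 - A) = (\<Prod>i\<in>UNIV. a - l i)"
proof -
  have QQ: "Q ** transpose Q = mat 1" using Q by (simp add: orthogonal_matrix_def)
  have "(Q ** (a *\<^sub>R mat 1 - A) ** transpose Q) *v x = diagonal_matrix (\<lambda>i. a - l i) *v x" for x
  proof -
    have "(Q ** (a *\<^sub>R mat 1 - A) ** transpose Q) *v x = Q *v ((a *\<^sub>R mat 1 - A) *v (transpose Q *v x))"
      by (simp only: matrix_vector_mul_assoc matrix_mul_assoc)
    also have "\<dots> = a *\<^sub>R (Q *v (transpose Q *v x)) - Q *v (A *v (transpose Q *v x))"
      by (simp only: matrix_vector_mult_diff_rdistrib matrix_vector_mult_diff_distrib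
          scaleR_matrix_vector_assoc[symmetric] matrix_vector_mul_lid matrix_vector_mult_scaleR)
    also have "\<dots> = a *\<^sub>R x - diagonal_matrix l *v x"
      by (simp only: matrix_vector_mul_assoc QQ diag matrix_mul_assoc matrix_vector_mul_lid)
    also have "\<dots> = diagonal_matrix (\<lambda>i. a - l i) *v x"
      by (simp add: vec_eq_iff algebra_simps)
    finally show ?thesis .
  qed
  then have "Q ** (a *\<^sub>R mat 1 - A) ** transpose Q = diagonal_matrix (\<lambda>i. a - l i)"
    by (simp add: matrix_eq)
  then have "det (Q ** (a *\<^sub>R mat 1 - A) ** transpose Q) = det (diagonal_matrix (\<lambda>i. a - l i))"
    by simp
  also have "\<dots> = (\<Prod>i\<in>UNIV. a - l i)"
    by (subst det_diagonal) (auto simp: diagonal_matrix_def)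
  also have "det (Q ** (a *\<^sub>R mat 1 - A) ** transpose Q) = det (a *\<^sub>R mat 1 - A)"
    using det_orthogonal_matrix[OF Q] by (auto simp: det_mul)
  finally show ?thesis .
qed

lemma det_diagonalization: "det A = (\<Prod>i\<in>UNIV. l i)"
proof -
  have "det (diagonal_matrix l) = (\<Prod>i\<in>UNIV. l i)"
    by (subst det_diagonal) (auto simp: diagonal_matrix_def)
  moreover have "det (Q ** A ** transpose Q) = det A"
    using det_orthogonal_matrix[OF Q] by (auto simp: det_mul)
  ultimately show ?thesis using diag by simp
qed

text \<open>\<open>charpoly\<close> is a determinant over the polynomial ring. Evaluation at each
  real \<open>a\<close> turns it into a real determinant, and a real polynomial is determined by its
  values.\<close>

lemma charpoly_diagonalization: "charpoly A = (\<Prod>i\<in>UNIV. [:- l i, 1:])"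
proof -
  have "poly (charpoly A) a = poly (\<Prod>i\<in>UNIV. [:- l i, 1:]) a" for a
  proof -
    have "poly (charpoly A) a = det (a *\<^sub>R mat 1 - A)"
      unfolding charpoly_def det_def
      by (auto simp: poly_sum poly_prod mat_def intro!: sum.cong prod.cong)
    then show ?thesis by (simp add: det_diagonalization_shift poly_prod)
  qed
  then show ?thesis by (simp add: poly_eq_poly_eq_iff[symmetric] fun_eq_iff)
qed

text \<open>The \<open>order\<close> of \<open>a\<close> in the product of linear factors counts the
  indices with \<open>l i = a\<close>; summing over the negative roots adds up the fibres of
  \<open>l\<close>.\<close>

lemma negativity_index_diagonalization: "negativity_index A = card {i. l i < 0}"
proof -
  have order: "order a (\<Prod>i\<in>I. [:- l i, 1:]) = card {i\<in>I. l i = a}" for a and I :: "'n set"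
  proof (induction I rule: infinite_finite_induct)
    case (insert i I)
    have "[:- l i, 1:] * (\<Prod>i\<in>I. [:- l i, 1:]) \<noteq> 0"
      by (subst mult_eq_0_iff) (use insert.hyps in auto)
    then have "order a ([:- l i, 1:] * (\<Prod>i\<in>I. [:- l i, 1:])) =
        order a [:- l i, 1:] + order a (\<Prod>i\<in>I. [:- l i, 1:])"
      by (rule order_mult)
    moreover have "order a [:- l i, 1:] = (if l i = a then 1 else 0)"
      using order_power_n_n[of a 1] by (auto intro: order_0I)
    ultimately have "order a ([:- l i, 1:] * (\<Prod>i\<in>I. [:- l i, 1:])) =
        (if l i = a then 1 else 0) + card {j \<in> I. l j = a}"
      by (simp only: insert.IH)
    moreover have "{j \<in> insert i I. l j = a} = (if l i = a then {i} else {}) \<union> {j \<in> I. l j = a}"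
      by auto
    ultimately show ?case using insert.hyps by (simp only: prod.insert) auto
  qed simp_all
  have "{a. a < 0 \<and> poly (charpoly A) a = 0} = l ` {i. l i < 0}"
    by (auto simp: charpoly_diagonalization poly_prod)
  then have "negativity_index A = (\<Sum>a\<in>l ` {i. l i < 0}. card {i. l i = a})"
    by (simp add: negativity_index_def charpoly_diagonalization order)
  also have "\<dots> = (\<Sum>a\<in>l ` {i. l i < 0}. \<Sum>i\<in>{i \<in> {i. l i < 0}. l i = a}. 1)"
    by (intro sum.cong refl) (auto intro: arg_cong[where f = card])
  also have "\<dots> = (\<Sum>i\<in>{i. l i < 0}. 1)"
    by (rule sum.image_gen[symmetric]) simp
  finally show ?thesis by simp
qed

end

section \<open>Local and global degree\<close>

lemma jacobian_eqI:
  fixes G :: "real^'n \<Rightarrow> real^'n"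
  assumes "(G has_derivative (\<lambda>v. A *v v)) (at x)"
  shows "jacobian G x = A"
proof -
  have "((\<lambda>x. G x $ i) has_derivative (\<lambda>v. A $ i \<bullet> v)) (at x)" for i
    using bounded_linear.has_derivative[OF bounded_linear_vec_nth assms, of i]
    by (simp add: matrix_vector_mul_component)
  then have "gradient (\<lambda>y. G y $ i) x = A $ i" for i by (rule gradient_unique)
  then show ?thesis by (simp add: jacobian_def)
qed

lemma norm_orthogonal_matrix:
  fixes Q :: "real^'n^'n"
  assumes "orthogonal_matrix Q"
  shows "norm (Q *v x) = norm x"
  using assms orthogonal_transformation_matrix[of "(*v) Q"]
  by (simp add: orthogonal_transformation)

lemma finite_positive_lower_bound:
  fixes f :: "'a \<Rightarrow> real"
  assumes "finite S" "\<And>x. x \<in> S \<Longrightarrow> f x > 0"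
  obtains m where "m > 0" "\<And>x. x \<in> S \<Longrightarrow> m \<le> f x"
proof
  \<comment> \<open>The inserted \<open>1\<close> keeps the argument of \<open>Min\<close> nonempty
    when \<open>S\<close> is empty.\<close>
  show "Min (insert 1 (f ` S)) > 0" using assms by (auto simp: Min_gr_iff)
  show "\<And>x. x \<in> S \<Longrightarrow> Min (insert 1 (f ` S)) \<le> f x" using assms by (auto intro: Min_le)
qed

lemma compact_positive_lower_bound:
  fixes f :: "'a::topological_space \<Rightarrow> real"
  assumes "compact K" "continuous_on K f" "\<And>x. x \<in> K \<Longrightarrow> f x > 0"
  obtains m where "m > 0" "\<And>x. x \<in> K \<Longrightarrow> m \<le> f x"
proof (cases "K = {}")
  case True
  then show ?thesis using that[of 1] by simp
next
  case False
  then obtain z where "z \<in> K" "\<forall>x\<in>K. f z \<le> f x"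
    using continuous_attains_inf assms by blast
  then show ?thesis using that[of "f z"] assms(3) by blast
qed

text \<open>A continuous nonnegative function with zero integral over a nondegenerate box vanishes
  on it, but the bump function is positive at 0. Positivity allows this factor to be cancelled from
  the degree count.\<close>

lemma integral_bump_pos:
  assumes "\<delta> > 0"
  shows "integral UNIV (bump \<delta> :: 'a::euclidean_space \<Rightarrow> real) > 0"
proof -
  let ?b = "bump \<delta> :: 'a \<Rightarrow> real" and ?c = "\<delta> *\<^sub>R One :: 'a"
  have "x \<in> cbox (-?c) ?c" if "norm x < \<delta>" for x
    using that Basis_le_norm[of _ x] by (force simp: mem_box abs_le_iff)
  then have eq: "integral UNIV ?b = integral (cbox (-?c) ?c) ?b"
    using assms by (intro integral_UNIV_eq bump_eq_0) force+
  have cont: "continuous_on (cbox (-?c) ?c) ?b"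
    by (intro continuous_intros)
  have "?b 0 \<noteq> 0" using assms by (simp add: bump_def)
  moreover have "0 \<in> cbox (-?c) ?c" using assms by (simp add: mem_box)
  moreover have "box (-?c) ?c \<noteq> {}" using assms by (simp add: box_ne_empty)
  ultimately have "integral (cbox (-?c) ?c) ?b \<noteq> 0"
    using integral_cbox_eq_0_iff[OF cont] by (auto simp: bump_def)
  moreover have "integral (cbox (-?c) ?c) ?b \<ge> 0"
    by (intro integral_nonneg integrable_continuous cont) (simp add: bump_def)
  ultimately show ?thesis using eq by linarith
qed

lemma degree_integral_isometry:
  fixes B :: "real^'n^'n"
  assumes B: "\<And>y. norm (B *v y) = norm y" and "0 \<le> \<delta>" "\<delta> \<le> \<rho>"
  shows "degree_integral \<delta> (\<lambda>x. B *v (x - a)) (ball a \<rho>) = det B * integral UNIV (bump \<delta> :: real^'n \<Rightarrow> real)"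
proof -
  let ?b = "bump \<delta> :: real^'n \<Rightarrow> real"
  have "((\<lambda>x. B *v (x - a)) has_derivative (\<lambda>v. B *v v)) (at x)" for x
    by (auto intro!: derivative_eq_intros bounded_linear.has_derivative[OF matrix_vector_mul_bounded_linear])
  then have "jacobian (\<lambda>x. B *v (x - a)) x = B" for x by (rule jacobian_eqI)
  then have "degree_integral \<delta> (\<lambda>x. B *v (x - a)) (ball a \<rho>) = integral (ball a \<rho>) (\<lambda>x. ?b (x + - a) * det B)"
    by (simp add: degree_integral_def bump_def B)
  \<comment> \<open>Because \<open>\<delta> \<le> \<rho>\<close>, the translated bump function
    vanishes off the ball.\<close>
  also have "\<dots> = integral UNIV (\<lambda>x. ?b (x + - a) * det B)"
    by (rule integral_UNIV_eq[symmetric])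
       (use assms in \<open>auto simp: dist_norm norm_minus_commute intro!: bump_eq_0\<close>)
  also have "\<dots> = det B * integral UNIV (\<lambda>x. ?b (x + - a))"
    by (simp add: mult.commute)
  also obtain c where c: "cball 0 \<delta> \<subseteq> cbox (-c) (c::real^'n)"
    using bounded_subset_cbox_symmetric bounded_cball by meson
  have "integral UNIV (\<lambda>x. ?b (x + - a)) = integral UNIV ?b"
  proof (rule integral_UNIV_translate)
    fix x assume "x \<notin> cbox (-c) c"
    then have "x \<notin> cball 0 \<delta>" using c by blast
    then show "?b x = 0" using \<open>0 \<le> \<delta>\<close> by (intro bump_eq_0) auto
  qed
  finally show ?thesis .
qed

text \<open>With \<open>A = Q\<^sup>T diag(l) Q\<close>, the map is deformed to the isometry \<open>Q\<^sup>T diag(sgn l) Q\<close>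
  through maps that stay away from zero on small spheres.\<close>

lemma degree_integral_local:
  fixes P :: "real^'n \<Rightarrow> real^'n"
  assumes P: "polynomial_function P" and "P a = 0"
    and sym: "transpose (jacobian P a) = jacobian P a" and nz: "det (jacobian P a) \<noteq> 0"
  obtains r where "r > 0" "\<And>x. x \<in> ball a r \<Longrightarrow> P x = 0 \<Longrightarrow> x = a"
    "\<And>\<rho>. \<lbrakk>0 < \<rho>; \<rho> \<le> r\<rbrakk> \<Longrightarrow> \<exists>d>0. \<forall>\<delta>. 0 \<le> \<delta> \<and> \<delta> \<le> d \<longrightarrow>
      degree_integral \<delta> P (ball a \<rho>) = sgn (det (jacobian P a)) * integral UNIV (bump \<delta> :: real^'n \<Rightarrow> real)"
proof -
  define A where "A = jacobian P a"
  obtain Q l where Q: "orthogonal_matrix Q" and diag: "Q ** A ** transpose Q = diagonal_matrix l"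
    using spectral_theorem_real[of A] sym by (auto simp: A_def)
  have l0: "l i \<noteq> 0" for i
    using det_diagonalization[OF Q diag] nz by (simp add: A_def)
  obtain m0 where "m0 > 0" "\<And>i. i \<in> UNIV \<Longrightarrow> m0 \<le> \<bar>l i\<bar>"
    using finite_positive_lower_bound[of UNIV "\<lambda>i. \<bar>l i\<bar>"] l0 by auto
  \<comment> \<open>\<open>m0\<close> bounds the eigenvalues of \<open>A\<close> and
    \<open>1\<close> those of \<open>B\<close>, so \<open>m\<close> works at both ends of the
    deformation.\<close>
  define m where "m = min 1 m0"
  have m: "m > 0" "m \<le> 1" "m \<le> \<bar>l i\<bar>" for i
    using \<open>m0 > 0\<close> \<open>\<And>i. i \<in> UNIV \<Longrightarrow> m0 \<le> \<bar>l i\<bar>\<close>[of i] by (auto simp: m_def)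
  define B where "B = transpose Q ** diagonal_matrix (\<lambda>i. sgn (l i)) ** Q"
  have QQ: "transpose Q ** Q = mat 1" using Q by (simp add: orthogonal_matrix)
  have QT: "orthogonal_matrix (transpose Q)" using Q by simp
  have A_eq: "A = transpose Q ** diagonal_matrix l ** Q"
    by (simp add: diag[symmetric] matrix_mul_assoc QQ) (simp add: QQ flip: matrix_mul_assoc)
  have combination: "(1 - t) *\<^sub>R (A *v y) + t *\<^sub>R (B *v y) =
      transpose Q *v (diagonal_matrix (\<lambda>i. (1 - t) * l i + t * sgn (l i)) *v (Q *v y))" for t y
  proof -
    have "(1 - t) *\<^sub>R (A *v y) + t *\<^sub>R (B *v y) = transpose Q *v
      ((1 - t) *\<^sub>R (diagonal_matrix l *v (Q *v y)) + t *\<^sub>R (diagonal_matrix (\<lambda>i. sgn (l i)) *v (Q *v y)))"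
      unfolding A_eq B_def
      by (simp only: matrix_vector_mul_assoc[symmetric] matrix_vector_right_distrib matrix_vector_mult_scaleR)
    also have "(1 - t) *\<^sub>R (diagonal_matrix l *v (Q *v y)) + t *\<^sub>R (diagonal_matrix (\<lambda>i. sgn (l i)) *v (Q *v y)) =
      diagonal_matrix (\<lambda>i. (1 - t) * l i + t * sgn (l i)) *v (Q *v y)"
      by (simp add: vec_eq_iff algebra_simps)
    finally show ?thesis .
  qed
  have lower: "m * norm y \<le> norm ((1 - t) *\<^sub>R (A *v y) + t *\<^sub>R (B *v y))" if "0 \<le> t" "t \<le> 1" for t y
  proof -
    \<comment> \<open>\<open>l i\<close> and \<open>sgn (l i)\<close> have the same sign, so the
      interpolation cannot cancel; this dictates the choice of \<open>B\<close>.\<close>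
    have "m \<le> \<bar>(1 - t) * l i + t * sgn (l i)\<bar>" for i
    proof -
      have "(1 - t) * l i + t * sgn (l i) = sgn (l i) * ((1 - t) * \<bar>l i\<bar> + t)"
        by (cases "l i > 0") (simp_all add: sgn_if algebra_simps)
      then have "\<bar>(1 - t) * l i + t * sgn (l i)\<bar> = (1 - t) * \<bar>l i\<bar> + t"
        using that l0[of i] by (simp add: abs_mult abs_sgn_eq)
      moreover have "(1 - t) * m + t * m \<le> (1 - t) * \<bar>l i\<bar> + t * 1"
        using that m by (intro add_mono mult_left_mono) auto
      ultimately show ?thesis by (simp add: algebra_simps)
    qed
    then have "norm ((m *\<^sub>R (Q *v y)) $ i) \<le>
        norm ((diagonal_matrix (\<lambda>i. (1 - t) * l i + t * sgn (l i)) *v (Q *v y)) $ i)" for i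
      using m(1) by (simp add: abs_mult mult_right_mono)
    then have "norm (m *\<^sub>R (Q *v y)) \<le>
        norm (diagonal_matrix (\<lambda>i. (1 - t) * l i + t * sgn (l i)) *v (Q *v y))"
      by (rule norm_le_componentwise_cart)
    then show ?thesis
      unfolding combination norm_orthogonal_matrix[OF QT]
      using m(1) by (simp add: norm_orthogonal_matrix[OF Q])
  qed
  have B_norm: "norm (B *v y) = norm y" for y
  proof -
    have "norm (B *v y) = norm (diagonal_matrix (\<lambda>i. sgn (l i)) *v (Q *v y))"
      using combination[of 1 y] norm_orthogonal_matrix[OF QT] by simp
    also have "\<dots> = norm (Q *v y)"
      by (rule order_antisym; rule norm_le_componentwise_cart) (simp_all add: abs_mult abs_sgn_eq l0)
    finally show ?thesis by (simp add: norm_orthogonal_matrix[OF Q])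
  qed
  have det_B: "det B = sgn (det A)"
  proof -
    have "det B = (det Q)\<^sup>2 * (\<Prod>i\<in>UNIV. sgn (l i))"
      unfolding B_def by (simp add: det_mul power2_eq_square)
        (subst det_diagonal, auto simp: diagonal_matrix_def)
    moreover have "(det Q)\<^sup>2 = 1" using det_orthogonal_matrix[OF Q] by auto
    moreover have "(\<Prod>i\<in>I. sgn (l i)) = sgn (\<Prod>i\<in>I. l i)" for I
      by (induction I rule: infinite_finite_induct) (auto simp: sgn_mult)
    ultimately show ?thesis using det_diagonalization[OF Q diag] by simp
  qed
  have "(P has_derivative (\<lambda>v. A *v v)) (at a)"
    unfolding A_def by (rule has_derivative_jacobian[OF P])
  \<comment> \<open>The linear part has norm at least \<open>m * norm y\<close>; an error of at most
    half of that leaves \<open>m / 2 * norm y\<close>.\<close>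
  then obtain r where r: "r > 0" and approx:
    "\<And>x. norm (x - a) < r \<Longrightarrow> norm (P x - P a - A *v (x - a)) \<le> m / 2 * norm (x - a)"
    unfolding has_derivative_at_alt using m(1) half_gt_zero by blast
  have far: "m / 2 * dist a x \<le> norm ((1 - t) *\<^sub>R P x + t *\<^sub>R (B *v (x - a)))"
    if "0 \<le> t" "t \<le> 1" "dist a x < r" for t x
  proof -
    define y where "y = x - a"
    have y: "norm y = dist a x" by (simp add: y_def dist_norm norm_minus_commute)
    define e where "e = P x - A *v y"
    have "norm e \<le> m / 2 * norm y"
      using approx[of x] that y \<open>P a = 0\<close> by (simp add: e_def y_def)
    moreover have "norm ((1 - t) *\<^sub>R e) \<le> norm e"
      using that by (simp add: mult_left_le_one_le)
    moreover have "(1 - t) *\<^sub>R P x + t *\<^sub>R (B *v y) = ((1 - t) *\<^sub>R (A *v y) + t *\<^sub>R (B *v y)) + (1 - t) *\<^sub>R e"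
      by (simp add: e_def algebra_simps)
    moreover have "norm (u + v) \<ge> norm u - norm v" for u v :: "real^'n"
      using norm_triangle_ineq4[of "u + v" v] by simp
    ultimately have "m * norm y - m / 2 * norm y \<le> norm ((1 - t) *\<^sub>R P x + t *\<^sub>R (B *v y))"
      using lower[OF that(1,2), of y] by (smt (verit))
    then show ?thesis by (simp add: y flip: y_def)
  qed
  show ?thesis
  proof
    show "r > 0" by (rule r)
    show "x = a" if "x \<in> ball a r" "P x = 0" for x
      using far[of 0 x] that m(1) by (simp add: zero_le_mult_iff mult_le_0_iff)
    fix \<rho> assume \<rho>: "0 < \<rho>" "\<rho> \<le> r"
    \<comment> \<open>\<open>m / 2 * (\<rho> / 2)\<close> is the bound that \<open>far\<close> gives
      on the annulus from \<open>\<rho> / 2\<close> to \<open>\<rho>\<close>; the bound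
      \<open>\<rho>\<close> is the one needed to evaluate the isometry.\<close>
    define d where "d = min \<rho> (m / 2 * (\<rho> / 2))"
    have "degree_integral \<delta> P (ball a \<rho>) = sgn (det (jacobian P a)) * integral UNIV (bump \<delta> :: real^'n \<Rightarrow> real)"
      if \<delta>: "0 \<le> \<delta>" "\<delta> \<le> d" for \<delta>
    proof -
      have "polynomial_function (\<lambda>x. B *v (x - a))"
      proof -
        have "polynomial_function (\<lambda>x. B *v x - B *v a)"
          by (intro polynomial_function_diff polynomial_function_bounded_linear
              matrix_vector_mul_bounded_linear polynomial_function_const)
        then show ?thesis by (simp add: matrix_vector_mult_diff_distrib)
      qed
      then have "degree_integral \<delta> P (ball a \<rho>) = degree_integral \<delta> (\<lambda>x. B *v (x - a)) (ball a \<rho>)"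
      proof (rule degree_integral_homotopy[OF P])
        show "\<rho> / 2 < \<rho>" using \<rho> by simp
        show "0 \<le> \<delta>" by (rule \<delta>)
        fix t :: real and x assume t: "0 \<le> t" "t \<le> 1" and x: "\<rho> / 2 < dist a x" "dist a x < \<rho>"
        have "\<delta> \<le> m / 2 * (\<rho> / 2)" using \<delta> by (simp add: d_def)
        also have "\<dots> \<le> m / 2 * dist a x" using x m(1) by (intro mult_left_mono) auto
        also have "\<dots> \<le> norm ((1 - t) *\<^sub>R P x + t *\<^sub>R (B *v (x - a)))"
          using far t x \<rho> by simp
        finally show "\<delta> \<le> norm ((1 - t) *\<^sub>R P x + t *\<^sub>R (B *v (x - a)))" .
      qed
      also have "\<dots> = det B * integral UNIV (bump \<delta> :: real^'n \<Rightarrow> real)"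
        using \<delta> by (intro degree_integral_isometry B_norm) (auto simp: d_def)
      finally show ?thesis by (simp add: det_B A_def)
    qed
    moreover have "d > 0" using \<rho> m(1) by (simp add: d_def)
    ultimately show "\<exists>d>0. \<forall>\<delta>. 0 \<le> \<delta> \<and> \<delta> \<le> d \<longrightarrow> degree_integral \<delta> P (ball a \<rho>) =
        sgn (det (jacobian P a)) * integral UNIV (bump \<delta> :: real^'n \<Rightarrow> real)"
      by blast
  qed
qed

text \<open>On a large ball \<open>P\<close> is homotopic to the identity, so its degree is \<open>1\<close>; near its zeros
  the degree is the sum of the local signs.\<close>

theorem sum_sgn_det_jacobian_eq_1:
  fixes P :: "real^'n \<Rightarrow> real^'n"
  assumes P: "polynomial_function P"
    and outward: "\<And>x. R \<le> norm x \<Longrightarrow> x \<bullet> P x > 0" and "R > 0"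
    and sym: "\<And>x. P x = 0 \<Longrightarrow> transpose (jacobian P x) = jacobian P x"
    and nz: "\<And>x. P x = 0 \<Longrightarrow> det (jacobian P x) \<noteq> 0"
  shows "finite {x. P x = 0}"
    and "(\<Sum>x | P x = 0. sgn (det (jacobian P x))) = 1"
proof -
  let ?Z = "{x. P x = 0}"
  let ?I = "\<lambda>\<delta>. integral UNIV (bump \<delta> :: real^'n \<Rightarrow> real)"
  have P_cont: "continuous_on S P" for S
    by (rule continuous_on_polymonial_function[OF P])
  have Z_ball: "norm x < R" if "x \<in> ?Z" for x
    using outward[of x] that by (cases "R \<le> norm x") auto
  have "\<forall>a\<in>?Z. \<exists>r>0. (\<forall>x\<in>ball a r. P x = 0 \<longrightarrow> x = a) \<and>
      (\<forall>\<rho>. 0 < \<rho> \<and> \<rho> \<le> r \<longrightarrow> (\<exists>d>0. \<forall>\<delta>. 0 \<le> \<delta> \<and> \<delta> \<le> d \<longrightarrow>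
        degree_integral \<delta> P (ball a \<rho>) = sgn (det (jacobian P a)) * ?I \<delta>))"
  proof
    fix a assume "a \<in> ?Z"
    then have "P a = 0" by simp
    from degree_integral_local[OF P this sym[OF this] nz[OF this]] obtain r
      where "r > 0" "\<And>x. x \<in> ball a r \<Longrightarrow> P x = 0 \<Longrightarrow> x = a"
        "\<And>\<rho>. 0 < \<rho> \<Longrightarrow> \<rho> \<le> r \<Longrightarrow> \<exists>d>0. \<forall>\<delta>. 0 \<le> \<delta> \<and> \<delta> \<le> d \<longrightarrow>
          degree_integral \<delta> P (ball a \<rho>) = sgn (det (jacobian P a)) * ?I \<delta>"
      by metis
    then show "\<exists>r>0. (\<forall>x\<in>ball a r. P x = 0 \<longrightarrow> x = a) \<and>
      (\<forall>\<rho>. 0 < \<rho> \<and> \<rho> \<le> r \<longrightarrow> (\<exists>d>0. \<forall>\<delta>. 0 \<le> \<delta> \<and> \<delta> \<le> d \<longrightarrow>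
        degree_integral \<delta> P (ball a \<rho>) = sgn (det (jacobian P a)) * ?I \<delta>))"
      by (intro exI[of _ r]) auto
  qed
  from bchoice[OF this] obtain r where r: "\<And>a. a \<in> ?Z \<Longrightarrow> r a > 0"
    "\<And>a x. a \<in> ?Z \<Longrightarrow> x \<in> ball a (r a) \<Longrightarrow> P x = 0 \<Longrightarrow> x = a"
    "\<And>a \<rho>. a \<in> ?Z \<Longrightarrow> 0 < \<rho> \<Longrightarrow> \<rho> \<le> r a \<Longrightarrow> \<exists>d>0. \<forall>\<delta>. 0 \<le> \<delta> \<and> \<delta> \<le> d \<longrightarrow>
        degree_integral \<delta> P (ball a \<rho>) = sgn (det (jacobian P a)) * ?I \<delta>"
    by blast

  have Z_closed: "closed ?Z"
    using continuous_closed_vimage[of "{0}" P] P_cont[of UNIV]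
    by (simp add: continuous_on_eq_continuous_at vimage_def)
  have "finite (cball 0 R \<inter> ?Z)"
  proof (rule finite_not_islimpt_in_compact)
    fix z :: "real^'n"
    show "\<not> z islimpt ?Z"
    proof
      assume lim: "z islimpt ?Z"
      then have "z \<in> ?Z" using Z_closed closed_limpt by blast
      from lim have "\<exists>y\<in>?Z. y \<noteq> z \<and> dist y z < r z"
        using r(1)[OF \<open>z \<in> ?Z\<close>] by (auto simp: islimpt_approachable)
      then show False using r(2)[OF \<open>z \<in> ?Z\<close>] by (auto simp: dist_commute)
    qed
  qed simp
  moreover have "cball 0 R \<inter> ?Z = ?Z" by (auto dest: Z_ball[OF CollectI])
  ultimately show fin: "finite ?Z" by simp

  \<comment> \<open>Half of \<open>r a\<close> makes the balls around distinct zeros disjoint;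
    \<open>R - norm a\<close> keeps them inside the large ball.\<close>
  obtain \<rho> where \<rho>: "\<rho> > 0" "\<And>a. a \<in> ?Z \<Longrightarrow> \<rho> \<le> min (r a / 2) (R - norm a)"
    using finite_positive_lower_bound[OF fin, of "\<lambda>a. min (r a / 2) (R - norm a)"] r(1) Z_ball
    by auto
  have "\<forall>a\<in>?Z. \<exists>d>0. \<forall>\<delta>. 0 \<le> \<delta> \<and> \<delta> \<le> d \<longrightarrow>
        degree_integral \<delta> P (ball a \<rho>) = sgn (det (jacobian P a)) * ?I \<delta>"
  proof
    fix a assume a: "a \<in> ?Z"
    then have "\<rho> \<le> r a" using \<rho>(2)[OF a] r(1)[OF a] by simp
    then show "\<exists>d>0. \<forall>\<delta>. 0 \<le> \<delta> \<and> \<delta> \<le> d \<longrightarrow>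
        degree_integral \<delta> P (ball a \<rho>) = sgn (det (jacobian P a)) * ?I \<delta>"
      by (rule r(3)[OF a \<rho>(1)])
  qed
  from bchoice[OF this] obtain d where d: "\<And>a. a \<in> ?Z \<Longrightarrow> d a > 0"
    "\<And>a \<delta>. a \<in> ?Z \<Longrightarrow> 0 \<le> \<delta> \<Longrightarrow> \<delta> \<le> d a \<Longrightarrow>
        degree_integral \<delta> P (ball a \<rho>) = sgn (det (jacobian P a)) * ?I \<delta>"
    by blast
  obtain d0 where d0: "d0 > 0" "\<And>a. a \<in> ?Z \<Longrightarrow> d0 \<le> d a"
    using finite_positive_lower_bound[OF fin, of d] d(1) by blast
  let ?U = "\<Union>a\<in>?Z. ball a \<rho>"
  \<comment> \<open>For \<open>\<delta>\<close> up to \<open>d1\<close>, the function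
    \<open>bump \<delta> (P x)\<close> vanishes on the large ball outside the small ones.\<close>
  obtain d1 where d1: "d1 > 0" "\<And>x. x \<in> cball 0 (R + 1) - ?U \<Longrightarrow> d1 \<le> norm (P x)"
  proof (rule compact_positive_lower_bound[of "cball 0 (R + 1) - ?U" "\<lambda>x. norm (P x)"])
    show "compact (cball 0 (R + 1) - ?U)" by (intro compact_diff) auto
    show "norm (P x) > 0" if "x \<in> cball 0 (R + 1) - ?U" for x
      using that \<rho>(1) by force
  qed (auto intro!: continuous_intros P_cont)
  let ?K = "{0..1} \<times> (cball 0 (R + 1) - ball 0 R) :: (real \<times> (real^'n)) set"
  \<comment> \<open>On the shell between \<open>R\<close> and \<open>R + 1\<close>, every point of
    the segment from \<open>P x\<close> to \<open>x\<close> has positive inner product with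
    \<open>x\<close>, hence is nonzero. This shell is the annulus for the homotopy to the
    identity.\<close>
  obtain d2 where d2: "d2 > 0"
    "\<And>z. z \<in> ?K \<Longrightarrow> d2 \<le> norm ((1 - fst z) *\<^sub>R P (snd z) + fst z *\<^sub>R snd z)"
  proof (rule compact_positive_lower_bound[of ?K "\<lambda>z. norm ((1 - fst z) *\<^sub>R P (snd z) + fst z *\<^sub>R snd z)"])
    show "compact ?K" by (intro compact_Times compact_diff) auto
    show "continuous_on ?K (\<lambda>z. norm ((1 - fst z) *\<^sub>R P (snd z) + fst z *\<^sub>R snd z))"
      by (intro continuous_intros continuous_on_compose2[OF P_cont[of UNIV]]) auto
    show "norm ((1 - fst z) *\<^sub>R P (snd z) + fst z *\<^sub>R snd z) > 0" if z: "z \<in> ?K" for z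
    proof -
      obtain t x where tx: "z = (t, x)" "0 \<le> t" "t \<le> 1" "R \<le> norm x" using z by auto
      have "x \<bullet> ((1 - t) *\<^sub>R P x + t *\<^sub>R x) = (1 - t) * (x \<bullet> P x) + t * (x \<bullet> x)"
        by (simp add: inner_add_right)
      also have "\<dots> > 0"
      proof (cases "t = 1")
        case True
        then show ?thesis using tx \<open>R > 0\<close> by (auto simp: inner_gt_zero_iff)
      next
        case False
        then have "(1 - t) * (x \<bullet> P x) > 0" using tx outward[of x] by simp
        moreover have "t * (x \<bullet> x) \<ge> 0" using tx by simp
        ultimately show ?thesis by linarith
      qed
      finally show ?thesis using tx by auto
    qed
  qed (rule that)

  \<comment> \<open>The four bounds serve, in order, the local degrees, the region off the small
    balls, the homotopy, and \<open>\<delta> \<le> R + 1\<close> for evaluating the identity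
    map.\<close>
  define \<delta> where "\<delta> = Min {d0, d1, d2, 1}"
  have \<delta>: "\<delta> > 0" "\<delta> \<le> d0" "\<delta> \<le> d1" "\<delta> \<le> d2" "\<delta> \<le> 1"
    using d0(1) d1(1) d2(1) by (auto simp: \<delta>_def)
  let ?B = "ball (0::real^'n) (R + 1)"
  define f where "f x = bump \<delta> (P x) * det (jacobian P x)" for x
  have f_cont: "continuous_on S f" for S
    unfolding f_def jacobian_def
    by (intro continuous_on_mult continuous_on_bump P_cont continuous_on_det)
       (auto intro!: real_polynomial_function_imp_continuous_on
         real_polynomial_function_partial_deriv polynomial_function_vec_nth[OF P])
  have f_on: "(\<lambda>x. if x \<in> ball a \<rho> then f x else 0) integrable_on UNIV" for a
  proof -
    obtain c where c: "ball a \<rho> \<subseteq> cbox (-c) c"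
      using bounded_subset_cbox_symmetric bounded_ball by meson
    have "f absolutely_integrable_on ball a \<rho>"
      by (rule set_integrable_subset[OF absolutely_integrable_continuous[OF f_cont] _ c]) simp
    then have "f integrable_on ball a \<rho>" by (rule set_lebesgue_integral_eq_integral)
    then show ?thesis using integrable_restrict_UNIV[of "ball a \<rho>" f] by blast
  qed
  have split: "(if x \<in> ?B then f x else 0) = (\<Sum>a\<in>?Z. if x \<in> ball a \<rho> then f x else 0)" for x
  proof (cases "x \<in> ?U")
    case True
    then obtain a where a: "a \<in> ?Z" "x \<in> ball a \<rho>" by auto
    have unique: "b = a" if "b \<in> ?Z" "x \<in> ball b \<rho>" for b
    proof (rule r(2)[OF a(1)])
      have "dist a b \<le> dist a x + dist b x" by (rule dist_triangle2)
      also have "\<dots> < 2 * \<rho>" using a that by simp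
      also have "\<dots> \<le> r a" using \<rho>(2)[OF a(1)] by simp
      finally show "b \<in> ball a (r a)" by simp
      show "P b = 0" using that by simp
    qed
    have "(\<Sum>b\<in>?Z. if x \<in> ball b \<rho> then f x else 0) = (\<Sum>b\<in>?Z. if b = a then f x else 0)"
    proof (rule sum.cong[OF refl])
      fix b assume "b \<in> ?Z"
      then show "(if x \<in> ball b \<rho> then f x else 0) = (if b = a then f x else 0)"
        using unique[of b] a(2) by metis
    qed
    also have "\<dots> = f x" using fin a(1) by simp
    also have "x \<in> ?B"
    proof -
      have "norm x \<le> norm a + dist a x" by (metis dist_0_norm dist_triangle)
      then show ?thesis using a \<rho>(2)[OF a(1)] by simp
    qed
    ultimately show ?thesis by simp
  next
    case False
    have "f x = 0" if "x \<in> ?B"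
      using d1(2)[of x] that False \<delta> by (auto simp: f_def intro!: bump_eq_0)
    moreover have "(\<Sum>a\<in>?Z. if x \<in> ball a \<rho> then f x else 0) = 0"
      using False by (intro sum.neutral) auto
    ultimately show ?thesis by simp
  qed
  have "degree_integral \<delta> P ?B = integral UNIV (\<lambda>x. if x \<in> ?B then f x else 0)"
    unfolding degree_integral_def f_def Henstock_Kurzweil_Integration.integral_restrict_UNIV ..
  also have "\<dots> = (\<Sum>a\<in>?Z. integral UNIV (\<lambda>x. if x \<in> ball a \<rho> then f x else 0))"
    unfolding split by (rule integral_sum[OF fin f_on])
  also have "\<dots> = (\<Sum>a\<in>?Z. degree_integral \<delta> P (ball a \<rho>))"
    unfolding degree_integral_def f_def Henstock_Kurzweil_Integration.integral_restrict_UNIV ..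
  also have "\<dots> = (\<Sum>a\<in>?Z. sgn (det (jacobian P a)) * ?I \<delta>)"
  proof (rule sum.cong)
    fix a assume a: "a \<in> ?Z"
    show "degree_integral \<delta> P (ball a \<rho>) = sgn (det (jacobian P a)) * ?I \<delta>"
      by (rule d(2)[OF a]) (use \<delta> d0(2)[OF a] in auto)
  qed simp
  finally have local: "degree_integral \<delta> P ?B = (\<Sum>a\<in>?Z. sgn (det (jacobian P a))) * ?I \<delta>"
    by (simp add: sum_distrib_right)
  have "degree_integral \<delta> P ?B = degree_integral \<delta> (\<lambda>x. x) ?B"
  proof (rule degree_integral_homotopy[OF P polynomial_function_id])
    fix t :: real and x :: "real^'n" assume "0 \<le> t" "t \<le> 1" "R < dist 0 x" "dist 0 x < R + 1"
    then show "\<delta> \<le> norm ((1 - t) *\<^sub>R P x + t *\<^sub>R x)"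
      using d2(2)[of "(t, x)"] \<delta> by simp
  qed (use \<delta> in auto)
  also have "\<dots> = ?I \<delta>"
    using degree_integral_isometry[of "mat 1 :: real^'n^'n" \<delta> "R + 1" 0] \<delta> \<open>R > 0\<close> by simp
  finally show "(\<Sum>a\<in>?Z. sgn (det (jacobian P a))) = 1"
    using local integral_bump_pos[OF \<delta>(1), where 'a = "real^'n"] by simp
qed

section \<open>Second order conditions\<close>

text \<open>The two sides take their partial derivatives in opposite order; symmetry of second
  derivatives reconciles them.\<close>

lemma hessian_eq_jacobian:
  fixes p :: "real^'n \<Rightarrow> real"
  assumes "real_polynomial_function p"
  shows "hessian p x = jacobian (gradient p) x"
  using partial_deriv_commute[OF assms]
  by (simp add: vec_eq_iff hessian_def jacobian_nth)

lemma transpose_hessian: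
  fixes p :: "real^'n \<Rightarrow> real"
  assumes "real_polynomial_function p"
  shows "transpose (hessian p x) = hessian p x"
  using partial_deriv_commute[OF assms]
  by (simp add: vec_eq_iff hessian_def transpose_def)

lemma polynomial_function_gradient:
  fixes p :: "real^'n \<Rightarrow> real"
  assumes "real_polynomial_function p"
  shows "polynomial_function (gradient p)"
  unfolding gradient_def[abs_def]
  by (intro polynomial_function_vec_lambda real_polynomial_function_partial_deriv assms)

lemma has_derivative_gradient_hessian:
  fixes p :: "real^'n \<Rightarrow> real"
  assumes "real_polynomial_function p"
  shows "(gradient p has_derivative (\<lambda>v. hessian p x *v v)) (at x)"
  unfolding hessian_eq_jacobian[OF assms]
  by (intro has_derivative_jacobian polynomial_function_gradient assms)

lemma critical_point_iff_gradient:
  fixes p :: "real^'n \<Rightarrow> real"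
  assumes "real_polynomial_function p"
  shows "critical_point p x \<longleftrightarrow> gradient p x = 0"
proof
  assume "critical_point p x"
  then have "(p has_derivative (\<lambda>h. 0 \<bullet> h)) (at x)" by (simp add: critical_point_def)
  then show "gradient p x = 0" by (rule gradient_unique)
next
  assume "gradient p x = 0"
  then show "critical_point p x"
    using has_derivative_real_polynomial_function[OF assms, of x] by (simp add: critical_point_def)
qed

context
  fixes p :: "real^'n \<Rightarrow> real" and x :: "real^'n"
  assumes p: "real_polynomial_function p"
begin

lemma DERIV_along_line:
  "((\<lambda>t. p (x + t *\<^sub>R v)) has_real_derivative gradient p (x + t *\<^sub>R v) \<bullet> v) (at t)"
proof -
  have "((\<lambda>s. x + s *\<^sub>R v) has_derivative (\<lambda>s. s *\<^sub>R v)) (at t)"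
    by (auto intro!: derivative_eq_intros)
  from has_derivative_compose[OF this has_derivative_real_polynomial_function[OF p]]
  show ?thesis
    unfolding has_field_derivative_def by (rule has_derivative_eq_rhs) (simp add: fun_eq_iff)
qed

lemma DERIV_gradient_along_line:
  "((\<lambda>t. gradient p (x + t *\<^sub>R v) \<bullet> v) has_real_derivative v \<bullet> (hessian p x *v v)) (at 0)"
proof -
  have "((\<lambda>s. x + s *\<^sub>R v) has_derivative (\<lambda>s. s *\<^sub>R v)) (at 0)"
    by (auto intro!: derivative_eq_intros)
  moreover have "(gradient p has_derivative (\<lambda>v. hessian p x *v v)) (at (x + 0 *\<^sub>R v))"
    using has_derivative_gradient_hessian[OF p, of x] by simp
  ultimately have "((\<lambda>s. gradient p (x + s *\<^sub>R v)) has_derivative (\<lambda>s. hessian p x *v (s *\<^sub>R v))) (at 0)"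
    by (rule has_derivative_compose)
  from has_derivative_inner_left[OF this, of v]
  show ?thesis
    unfolding has_field_derivative_def
    by (rule has_derivative_eq_rhs) (simp add: fun_eq_iff matrix_vector_mult_scaleR inner_commute)
qed

text \<open>A negative value at \<open>v\<close> makes the derivative along \<open>v\<close>, which
  is 0 at \<open>x\<close>, negative just beyond it. By the mean value theorem \<open>p\<close> then
  drops below \<open>p x\<close> arbitrarily close to \<open>x\<close>.\<close>

lemma local_min_imp_hessian_nonneg:
  assumes min: "local_min_at p x" and crit: "gradient p x = 0"
  shows "0 \<le> v \<bullet> (hessian p x *v v)"
proof (rule ccontr)
  assume neg: "\<not> 0 \<le> v \<bullet> (hessian p x *v v)"
  then have "v \<noteq> 0" by auto
  obtain d where d: "d > 0" "\<And>h. 0 < h \<Longrightarrow> h < d \<Longrightarrow> gradient p (x + h *\<^sub>R v) \<bullet> v < 0"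
    using DERIV_neg_dec_right[OF DERIV_gradient_along_line, of v] neg crit by auto
  obtain e where e: "e > 0" "\<And>y. dist y x < e \<Longrightarrow> p x \<le> p y"
    using min by (auto simp: local_min_at_def)
  define h where "h = min (d / 2) (e / (2 * norm v))"
  have h: "0 < h" "h < d" "h * norm v < e"
  proof -
    show "0 < h" "h < d" using d e \<open>v \<noteq> 0\<close> by (auto simp: h_def)
    have "h * norm v \<le> e / (2 * norm v) * norm v"
      unfolding h_def by (intro mult_right_mono) auto
    also have "\<dots> < e" using e \<open>v \<noteq> 0\<close> by simp
    finally show "h * norm v < e" .
  qed
  obtain z where z: "0 < z" "z < h"
    "p (x + h *\<^sub>R v) - p (x + 0 *\<^sub>R v) = (h - 0) * (gradient p (x + z *\<^sub>R v) \<bullet> v)"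
    using MVT2[OF h(1), of "\<lambda>t. p (x + t *\<^sub>R v)" "\<lambda>t. gradient p (x + t *\<^sub>R v) \<bullet> v"]
      DERIV_along_line by blast
  have "p (x + h *\<^sub>R v) < p x"
  proof -
    have "h * (gradient p (x + z *\<^sub>R v) \<bullet> v) < 0"
      using z h d(2)[of z] by (intro mult_pos_neg) auto
    then show ?thesis using z(3) by simp
  qed
  moreover have "p x \<le> p (x + h *\<^sub>R v)"
    using h by (intro e(2)) (simp add: dist_norm)
  ultimately show False by simp
qed

text \<open>A first order expansion of the gradient suffices: with error at most
  \<open>m * norm (y - x)\<close>, the gradient at \<open>y\<close> has nonnegative inner product
  with \<open>y - x\<close>, and the mean value theorem on the segment concludes.\<close>

lemma hessian_pos_imp_local_min:
  assumes crit: "gradient p x = 0" and "m > 0"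
    and pos: "\<And>v. m * (v \<bullet> v) \<le> v \<bullet> (hessian p x *v v)"
  shows "local_min_at p x"
proof -
  obtain r where r: "r > 0" and approx: "\<And>y. norm (y - x) < r \<Longrightarrow>
      norm (gradient p y - gradient p x - hessian p x *v (y - x)) \<le> m * norm (y - x)"
    using has_derivative_gradient_hessian[OF p, of x] \<open>m > 0\<close> unfolding has_derivative_at_alt by blast
  have mono: "0 \<le> gradient p y \<bullet> (y - x)" if "norm (y - x) < r" for y
  proof -
    define v where "v = y - x"
    define e where "e = gradient p y - hessian p x *v v"
    have "norm e \<le> m * norm v" using approx[OF that] crit by (simp add: e_def v_def)
    then have "norm e * norm v \<le> m * norm v * norm v" by (rule mult_right_mono) simp
    then have "\<bar>e \<bullet> v\<bar> \<le> m * (v \<bullet> v)"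
      using Cauchy_Schwarz_ineq2[of e v] by (simp add: dot_square_norm power2_eq_square mult.assoc)
    moreover have "gradient p y \<bullet> v = v \<bullet> (hessian p x *v v) + e \<bullet> v"
      unfolding e_def inner_diff_left by (simp add: inner_commute)
    ultimately show ?thesis using pos[of v] by (simp add: v_def)
  qed
  show ?thesis
    unfolding local_min_at_def
  proof (intro exI conjI allI impI)
    show "r > 0" by (rule r)
    fix y assume y: "dist y x < r"
    define v where "v = y - x"
    obtain z where z: "0 < z" "z < 1"
      "p (x + 1 *\<^sub>R v) - p (x + 0 *\<^sub>R v) = (1 - 0) * (gradient p (x + z *\<^sub>R v) \<bullet> v)"
      using MVT2[of 0 1 "\<lambda>t. p (x + t *\<^sub>R v)" "\<lambda>t. gradient p (x + t *\<^sub>R v) \<bullet> v"]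
        DERIV_along_line by auto
    have "z * norm v \<le> norm v" using z by (simp add: mult_left_le_one_le)
    then have "norm (x + z *\<^sub>R v - x) < r" using y z by (simp add: v_def dist_norm)
    from mono[OF this] have "0 \<le> gradient p (x + z *\<^sub>R v) \<bullet> v" using z by (simp add: zero_le_mult_iff)
    then show "p x \<le> p y" using z by (simp add: v_def)
  qed
qed

lemma sgn_det_hessian_local_min:
  assumes min: "local_min_at p x" and crit: "gradient p x = 0" and nz: "det (hessian p x) \<noteq> 0"
  shows "sgn (det (hessian p x)) = 1"
proof -
  obtain Q l where Q: "orthogonal_matrix Q" "Q ** hessian p x ** transpose Q = diagonal_matrix l"
    using spectral_theorem_real[OF transpose_hessian[OF p]] by metis
  obtain e where e: "\<And>i. e i \<bullet> (hessian p x *v e i) = l i"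
    using diagonalization_eigenvectors[OF Q] by metis
  have "l i \<ge> 0" for i
    using local_min_imp_hessian_nonneg[OF min crit, of "e i"] e by simp
  moreover have "l i \<noteq> 0" for i
    using det_diagonalization[OF Q] nz by simp
  ultimately have "det (hessian p x) > 0"
    unfolding det_diagonalization[OF Q] by (intro prod_pos) (simp add: order_less_le)
  then show ?thesis by simp
qed

text \<open>With no negative eigenvalue the Hessian would be positive definite and \<open>x\<close>
  a local minimum; a second negative one would contradict \<open>trace\<close> for two orthonormal
  eigenvectors.\<close>

lemma saddle_index_one:
  assumes not_min: "\<not> local_min_at p x" and crit: "gradient p x = 0" and nz: "det (hessian p x) \<noteq> 0"
    and trace: "\<And>a b. \<lbrakk>norm a = 1; norm b = 1; a \<bullet> b = 0\<rbrakk> \<Longrightarrow>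
      a \<bullet> (hessian p x *v a) + b \<bullet> (hessian p x *v b) > 0"
  shows "negativity_index (hessian p x) = 1" and "sgn (det (hessian p x)) = -1"
proof -
  obtain Q l where Q: "orthogonal_matrix Q" "Q ** hessian p x ** transpose Q = diagonal_matrix l"
    using spectral_theorem_real[OF transpose_hessian[OF p]] by metis
  obtain e where e: "\<And>i j. e i \<bullet> e j = (if i = j then 1 else 0)"
    "\<And>i. e i \<bullet> (hessian p x *v e i) = l i"
    using diagonalization_eigenvectors[OF Q] by metis
  have l0: "l i \<noteq> 0" for i
    using det_diagonalization[OF Q] nz by simp
  have "\<exists>k. l k < 0"
  proof (rule ccontr)
    assume "\<nexists>k. l k < 0"
    then have pos: "l i > 0" for i using l0[of i] by (metis linorder_neqE_linordered_idom)
    obtain m where m: "m > 0" "\<And>i. i \<in> UNIV \<Longrightarrow> m \<le> l i"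
      using finite_positive_lower_bound[of UNIV l] pos by auto
    have "m * (v \<bullet> v) \<le> v \<bullet> (hessian p x *v v)" for v
    proof -
      have "m * (v \<bullet> v) = (\<Sum>i\<in>UNIV. m * ((Q *v v) $ i)\<^sup>2)"
        using norm_orthogonal_matrix[OF Q(1), of v]
        by (simp add: norm_eq inner_vec_def power2_eq_square flip: sum_distrib_left)
      also have "\<dots> \<le> v \<bullet> (hessian p x *v v)"
        unfolding diagonalization_inner[OF Q] using m by (intro sum_mono mult_right_mono) auto
      finally show ?thesis .
    qed
    then have "local_min_at p x" by (rule hessian_pos_imp_local_min[OF crit m(1)])
    then show False using not_min by simp
  qed
  then obtain k where k: "l k < 0" by blast
  have pos: "l i > 0" if "i \<noteq> k" for i
    using trace[of "e i" "e k"] that e k by (simp add: norm_eq_1)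
  then have "{i. l i < 0} = {k}" using k by (force simp: not_less_iff_gr_or_eq)
  then show "negativity_index (hessian p x) = 1"
    by (simp add: negativity_index_diagonalization[OF Q])
  have "det (hessian p x) = l k * (\<Prod>i\<in>UNIV - {k}. l i)"
    unfolding det_diagonalization[OF Q] by (rule prod.remove) auto
  moreover have "(\<Prod>i\<in>UNIV - {k}. l i) > 0" using pos by (intro prod_pos) auto
  ultimately have "det (hessian p x) < 0" using k by (simp add: mult_neg_pos)
  then show "sgn (det (hessian p x)) = -1" by simp
qed

end

section \<open>Products of squared distances\<close>

lemma aff_dim_plane:
  fixes a b c :: "'a::euclidean_space"
  assumes "norm a = 1" "norm b = 1" "a \<bullet> b = 0"
  shows "affine ((+) c ` span {a, b})" and "aff_dim ((+) c ` span {a, b}) = 2"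
proof -
  show "affine ((+) c ` span {a, b})"
    using affine_translation subspace_imp_affine[OF subspace_span] by blast
  have "a \<noteq> b" using assms by (auto simp: norm_eq_1)
  have "pairwise orthogonal {a, b}" "0 \<notin> {a, b}"
    using assms by (auto simp: pairwise_insert orthogonal_def inner_commute)
  then have "independent {a, b}" by (rule pairwise_orthogonal_independent)
  then have "dim {a, b} = 2" using \<open>a \<noteq> b\<close> by (simp add: dim_eq_card_independent)
  then show "aff_dim ((+) c ` span {a, b}) = 2"
    by (simp add: aff_dim_translation_eq aff_dim_subspace)
qed

text \<open>Both parts are read off from the squared length of \<open>v\<close>, the component of
  \<open>u\<close> orthogonal to \<open>a\<close> and \<open>b\<close>.\<close>

lemma bessel_two:
  fixes a b u :: "'a::real_inner"
  assumes "norm a = 1" "norm b = 1" "a \<bullet> b = 0"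
  shows "(u \<bullet> a)\<^sup>2 + (u \<bullet> b)\<^sup>2 \<le> u \<bullet> u"
    and "(u \<bullet> a)\<^sup>2 + (u \<bullet> b)\<^sup>2 = u \<bullet> u \<Longrightarrow> u \<in> span {a, b}"
proof -
  define v where "v = u - (u \<bullet> a) *\<^sub>R a - (u \<bullet> b) *\<^sub>R b"
  have "v \<bullet> v = u \<bullet> u - ((u \<bullet> a)\<^sup>2 + (u \<bullet> b)\<^sup>2)"
    using assms
    by (simp add: v_def inner_diff_left inner_diff_right norm_eq_1 inner_commute power2_eq_square
        algebra_simps)
  then show "(u \<bullet> a)\<^sup>2 + (u \<bullet> b)\<^sup>2 \<le> u \<bullet> u"
    using inner_ge_zero[of v] by linarith
  assume "(u \<bullet> a)\<^sup>2 + (u \<bullet> b)\<^sup>2 = u \<bullet> u"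
  then have "v = 0" using \<open>v \<bullet> v = _\<close> by simp
  then have "u = (u \<bullet> a) *\<^sub>R a + (u \<bullet> b) *\<^sub>R b" by (simp add: v_def algebra_simps)
  also have "\<dots> \<in> span {a, b}" by (intro span_add span_scale span_base) auto
  finally show "u \<in> span {a, b}" .
qed

lemma sgn_sum_partition:
  fixes s :: "'a \<Rightarrow> real"
  assumes "finite A" "B \<subseteq> A" "\<And>x. x \<in> A - B \<Longrightarrow> s x = 1" "\<And>x. x \<in> B \<Longrightarrow> s x = -1"
  shows "sum s A = real (card (A - B)) - real (card B)"
proof -
  have "sum s A = sum s (A - B) + sum s B" using assms by (intro sum.subset_diff) auto
  also have "sum s (A - B) = real (card (A - B))" using assms(3) by simp
  also have "sum s B = - real (card B)" using assms(4) by simp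
  finally show ?thesis by simp
qed

context
  fixes W :: "(real^'n) set" and F :: "real^'n \<Rightarrow> real"
  assumes fin: "finite W"
  defines "F \<equiv> \<lambda>x. \<Prod>c\<in>W. (norm (x - c))\<^sup>2"
begin

lemma real_polynomial_function_dist_product: "real_polynomial_function F"
proof -
  have "real_polynomial_function (\<lambda>x::real^'n. (norm (x - c))\<^sup>2)" for c
  proof -
    have nth: "real_polynomial_function (\<lambda>x. x $ i)" for i :: 'n
      by (intro real_polynomial_function.intros(1) bounded_linear_vec_nth)
    have "real_polynomial_function (\<lambda>x::real^'n. \<Sum>i\<in>UNIV. (x $ i - c $ i) * (x $ i - c $ i))"
      by (intro real_polynomial_function_sum real_polynomial_function.intros(4)
          real_polynomial_function_diff nth real_polynomial_function.intros(2)) auto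
    then show ?thesis by (simp add: power2_norm_eq_inner inner_vec_def)
  qed
  then show ?thesis unfolding F_def by (intro real_polynomial_function_prod fin)
qed

lemma gradient_dist_product:
  "gradient F x = (\<Sum>c\<in>W. (2 * (\<Prod>d\<in>W - {c}. (norm (x - d))\<^sup>2)) *\<^sub>R (x - c))"
proof (rule gradient_unique)
  have "((\<lambda>x. (norm (x - c))\<^sup>2) has_derivative (\<lambda>h. 2 * ((x - c) \<bullet> h))) (at x)" for c
    unfolding power2_norm_eq_inner
    by (auto intro!: derivative_eq_intros simp: inner_commute)
  then have "(F has_derivative (\<lambda>h. \<Sum>c\<in>W. 2 * ((x - c) \<bullet> h) * (\<Prod>d\<in>W - {c}. (norm (x - d))\<^sup>2))) (at x)"
    unfolding F_def by (intro has_derivative_prod)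
  then show "(F has_derivative (\<lambda>h. (\<Sum>c\<in>W. (2 * (\<Prod>d\<in>W - {c}. (norm (x - d))\<^sup>2)) *\<^sub>R (x - c)) \<bullet> h)) (at x)"
    by (rule has_derivative_eq_rhs) (simp add: fun_eq_iff inner_sum_left mult_ac)
qed

text \<open>At \<open>c\<close> the summand of \<open>c\<close> has the zero vector, and every other
  summand has a product containing the factor of \<open>c\<close>, which is 0.\<close>

lemma gradient_dist_product_zero: "c \<in> W \<Longrightarrow> gradient F c = 0"
  unfolding gradient_dist_product
proof (intro sum.neutral ballI)
  fix d assume "c \<in> W" "d \<in> W"
  then show "(2 * (\<Prod>d\<in>W - {d}. (norm (c - d))\<^sup>2)) *\<^sub>R (c - d) = 0"
    using fin by (cases "c = d") (auto simp: prod_zero_iff)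
qed

lemma gradient_dist_product_log:
  assumes "x \<notin> W"
  shows "gradient F x = F x *\<^sub>R (\<Sum>c\<in>W. (2 / (norm (x - c))\<^sup>2) *\<^sub>R (x - c))"
  unfolding gradient_dist_product scaleR_sum_right
proof (rule sum.cong[OF refl])
  fix c assume c: "c \<in> W"
  have "F x = (norm (x - c))\<^sup>2 * (\<Prod>d\<in>W - {c}. (norm (x - d))\<^sup>2)"
    unfolding F_def by (rule prod.remove[OF fin c])
  moreover have "norm (x - c) \<noteq> 0" using assms c by auto
  ultimately show "(2 * (\<Prod>d\<in>W - {c}. (norm (x - d))\<^sup>2)) *\<^sub>R (x - c) =
      F x *\<^sub>R (2 / (norm (x - c))\<^sup>2) *\<^sub>R (x - c)"
    by simp
qed

lemma dist_product_eq_0_iff: "F x = 0 \<longleftrightarrow> x \<in> W"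
  using fin by (auto simp: F_def prod_zero_iff)

lemma dist_product_nonneg: "F x \<ge> 0"
  unfolding F_def by (intro prod_nonneg) simp

text \<open>The sum of norms bounds every \<open>norm c\<close>, strictly thanks to the
  \<open>+ 1\<close>; so each \<open>x - c\<close> points outward by Cauchy-Schwarz, with positive
  weight.\<close>

lemma gradient_dist_product_outward:
  assumes "W \<noteq> {}" "(\<Sum>c\<in>W. norm c) + 1 \<le> norm x"
  shows "x \<bullet> gradient F x > 0"
proof -
  have far: "norm c < norm x" if "c \<in> W" for c
  proof -
    have "norm c \<le> (\<Sum>c\<in>W. norm c)" using that fin by (intro member_le_sum) auto
    then show ?thesis using assms(2) by simp
  qed
  have "x \<bullet> (x - c) > 0" if "c \<in> W" for c
  proof -
    have "x \<bullet> c \<le> norm x * norm c" by (rule norm_cauchy_schwarz)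
    also have "\<dots> < norm x * norm x"
      using far[OF that] norm_ge_zero[of c] by (intro mult_strict_left_mono) linarith+
    finally show ?thesis by (simp add: inner_diff_right dot_square_norm power2_eq_square)
  qed
  moreover have "(\<Prod>d\<in>W - {c}. (norm (x - d))\<^sup>2) > 0" for c
  proof (intro prod_pos ballI)
    fix d assume "d \<in> W - {c}"
    then show "(norm (x - d))\<^sup>2 > 0" using far[of d] by auto
  qed
  ultimately show ?thesis
    unfolding gradient_dist_product inner_sum_right using fin \<open>W \<noteq> {}\<close>
    by (intro sum_pos) auto
qed

text \<open>Away from \<open>W\<close>, \<open>\<nabla>F = F \<nabla>(log F)\<close>, so at a critical point the Hessian of \<open>F\<close> is
  \<open>F\<close> times that of \<open>log F\<close>.\<close>

lemma hessian_dist_product: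
  assumes x: "x \<notin> W" and crit: "gradient F x = 0" and a: "norm a = 1"
  shows "a \<bullet> (hessian F x *v a) =
    F x * (\<Sum>c\<in>W. 2 / (norm (x - c))\<^sup>2 - 4 * ((x - c) \<bullet> a)\<^sup>2 / (norm (x - c)) ^ 4)"
proof -
  \<comment> \<open>The derivative of \<open>log F\<close> along the line through \<open>x\<close>
    in direction \<open>a\<close>, written without the logarithm; \<open>?S'\<close> is its
    derivative at 0.\<close>
  define S where "S t = (\<Sum>c\<in>W. 2 * ((x - c + t *\<^sub>R a) \<bullet> a) / ((x - c + t *\<^sub>R a) \<bullet> (x - c + t *\<^sub>R a)))" for t
  have gS: "gradient F (x + t *\<^sub>R a) \<bullet> a = F (x + t *\<^sub>R a) * S t" if "x + t *\<^sub>R a \<notin> W" for t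
  proof -
    have "x + t *\<^sub>R a - c = x - c + t *\<^sub>R a" for c by simp
    then show ?thesis
      unfolding gradient_dist_product_log[OF that] S_def
      by (simp only: inner_sum_left inner_scaleR_left power2_norm_eq_inner times_divide_eq_left)
  qed
  let ?S' = "\<Sum>c\<in>W. 2 / (norm (x - c))\<^sup>2 - 4 * ((x - c) \<bullet> a)\<^sup>2 / (norm (x - c)) ^ 4"
  have "((\<lambda>t. 2 * ((x - c + t *\<^sub>R a) \<bullet> a) / ((x - c + t *\<^sub>R a) \<bullet> (x - c + t *\<^sub>R a))) has_real_derivative
      2 / (norm (x - c))\<^sup>2 - 4 * ((x - c) \<bullet> a)\<^sup>2 / (norm (x - c)) ^ 4) (at 0)" if c: "c \<in> W" for c
  proof -
    define u where "u = x - c"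
    have "u \<bullet> u \<noteq> 0" using x c by (auto simp: u_def)
    have "a \<bullet> a = 1" using a by (simp add: norm_eq_1)
    have "((\<lambda>t. 2 * (u \<bullet> a + t) / (u \<bullet> u + 2 * t * (u \<bullet> a) + t\<^sup>2)) has_real_derivative
      2 / (u \<bullet> u) - 4 * (u \<bullet> a)\<^sup>2 / (u \<bullet> u)\<^sup>2) (at 0)"
      using \<open>u \<bullet> u \<noteq> 0\<close>
      by (auto intro!: derivative_eq_intros simp: divide_simps power2_eq_square algebra_simps)
    moreover have "2 * ((u + t *\<^sub>R a) \<bullet> a) / ((u + t *\<^sub>R a) \<bullet> (u + t *\<^sub>R a)) =
      2 * (u \<bullet> a + t) / (u \<bullet> u + 2 * t * (u \<bullet> a) + t\<^sup>2)" for t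
      using \<open>a \<bullet> a = 1\<close> by (simp add: inner_add_left inner_add_right inner_commute power2_eq_square algebra_simps)
    moreover have "(norm u) ^ 4 = (u \<bullet> u)\<^sup>2"
      by (simp flip: power2_norm_eq_inner)
    ultimately show ?thesis by (simp add: power2_norm_eq_inner flip: u_def)
  qed
  then have S_der: "(S has_real_derivative ?S') (at 0)"
    unfolding S_def by (intro DERIV_sum)
  note poly = real_polynomial_function_dist_product
  \<comment> \<open>At a critical point the factor \<open>F\<close> has derivative 0, so the product
    rule leaves only \<open>F x * ?S'\<close>.\<close>
  have "((\<lambda>t. F (x + t *\<^sub>R a)) has_real_derivative 0) (at 0)"
    using DERIV_along_line[OF poly, of x a 0] crit by simp
  from DERIV_mult[OF this S_der]
  have "((\<lambda>t. F (x + t *\<^sub>R a) * S t) has_real_derivative F x * ?S') (at 0)" by (simp add: mult.commute)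
  \<comment> \<open>\<open>gS\<close> holds off \<open>W\<close> only; the finite set
    \<open>W\<close> is closed, so this covers a neighbourhood of 0.\<close>
  moreover have "open ((\<lambda>t. x + t *\<^sub>R a) -` (- W))"
    by (intro open_vimage continuous_intros open_Compl finite_imp_closed fin)
  ultimately have "((\<lambda>t. gradient F (x + t *\<^sub>R a) \<bullet> a) has_real_derivative F x * ?S') (at 0)"
    by (rule has_field_derivative_transform_within_open) (use x gS in auto)
  with DERIV_gradient_along_line[OF poly] show ?thesis by (rule DERIV_unique)
qed

lemma hessian_dist_product_trace_pos:
  assumes x: "x \<notin> W" and crit: "gradient F x = 0"
    and ab: "norm a = 1" "norm b = 1" "a \<bullet> b = 0"
    and not_planar: "\<not> (\<exists>P. affine P \<and> aff_dim P = 2 \<and> W \<subseteq> P)"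
  shows "a \<bullet> (hessian F x *v a) + b \<bullet> (hessian F x *v b) > 0"
proof -
  define q where "q c = (x - c) \<bullet> (x - c)" for c
  \<comment> \<open>The squared distance of \<open>x - c\<close> from
    \<open>span {a, b}\<close>.\<close>
  define s where "s c = q c - (((x - c) \<bullet> a)\<^sup>2 + ((x - c) \<bullet> b)\<^sup>2)" for c
  have q: "q c > 0" if "c \<in> W" for c
    using that x by (auto simp: q_def)
  have s: "s c \<ge> 0" for c
    using bessel_two(1)[OF ab] by (simp add: s_def q_def)
  have "\<exists>c\<in>W. s c \<noteq> 0"
  proof (rule ccontr)
    assume "\<not> (\<exists>c\<in>W. s c \<noteq> 0)"
    then have "x - c \<in> span {a, b}" if "c \<in> W" for c
      using bessel_two(2)[OF ab] that by (simp add: s_def q_def)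
    then have "c \<in> (+) x ` span {a, b}" if "c \<in> W" for c
      using that span_neg[of "x - c" "{a, b}"] by (intro image_eqI[of _ _ "c - x"]) auto
    then show False using not_planar aff_dim_plane[OF ab, of x] by blast
  qed
  then obtain c0 where c0: "c0 \<in> W" "s c0 > 0" using s by (metis order_le_less)
  have "(\<Sum>c\<in>W. 4 * s c / (q c)\<^sup>2) > 0"
    using fin c0(1)
  proof (rule sum_pos2)
    show "4 * s c0 / (q c0)\<^sup>2 > 0" using c0 q[OF c0(1)] by simp
    show "4 * s c / (q c)\<^sup>2 \<ge> 0" for c using s[of c] by simp
  qed
  moreover have "F x > 0"
    using dist_product_nonneg[of x] dist_product_eq_0_iff[of x] x by simp
  moreover have "a \<bullet> (hessian F x *v a) + b \<bullet> (hessian F x *v b) = F x * (\<Sum>c\<in>W. 4 * s c / (q c)\<^sup>2)"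
  proof -
    have n4: "(norm (x - c)) ^ 4 = (q c)\<^sup>2" and n2: "(norm (x - c))\<^sup>2 = q c" for c
      by (simp_all add: q_def flip: power2_norm_eq_inner)
    have "(2 / q c - 4 * ((x - c) \<bullet> a)\<^sup>2 / (q c)\<^sup>2) + (2 / q c - 4 * ((x - c) \<bullet> b)\<^sup>2 / (q c)\<^sup>2) = 4 * s c / (q c)\<^sup>2"
      if "c \<in> W" for c
      using q[OF that] by (simp add: s_def power2_eq_square field_simps)
    then show ?thesis
      unfolding hessian_dist_product[OF x crit ab(1)] hessian_dist_product[OF x crit ab(2)] n4 n2
        distrib_left[symmetric] sum.distrib[symmetric]
      by simp
  qed
  ultimately show ?thesis by simp
qed

theorem dist_product_critical_points:
  assumes N3: "CARD('n) \<ge> 3"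
    and not_planar: "\<not> (\<exists>P. affine P \<and> aff_dim P = 2 \<and> W \<subseteq> P)"
    and morse: "\<forall>x. critical_point F x \<longrightarrow> det (hessian F x) \<noteq> 0"
  shows "let C = {x. critical_point F x};
             M = {x \<in> C - W. local_min_at F x};
             S = C - W - M
         in finite C \<and> W \<subseteq> C \<and> {x. \<forall>y. F x \<le> F y} = W \<and>
            card S = card W + card M - 1 \<and>
            (\<forall>x\<in>S. negativity_index (hessian F x) = 1)"
proof -
  define C where "C = {x. critical_point F x}"
  define M where "M = {x \<in> C - W. local_min_at F x}"
  define S where "S = C - W - M"
  note poly = real_polynomial_function_dist_product
  have C: "C = {x. gradient F x = 0}"
    by (simp add: C_def critical_point_iff_gradient[OF poly])
  have nz: "det (hessian F x) \<noteq> 0" if "x \<in> C" for x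
    using morse that by (simp add: C_def)
  \<comment> \<open>Two coordinate directions span a plane, and the empty set would lie in
    it.\<close>
  have "W \<noteq> {}"
  proof
    assume "W = {}"
    obtain i j :: 'n where "i \<noteq> j"
      using N3 by (metis (full_types) card_1_singleton_iff UNIV_I UNIV_eq_I insertI1 singletonD
          numeral_le_one_iff semiring_norm(70) One_nat_def)
    then have "affine ((+) 0 ` span {axis i 1, axis j (1::real)})"
      "aff_dim ((+) 0 ` span {axis i 1, axis j (1::real)}) = 2"
      by (intro aff_dim_plane; simp add: inner_axis_axis)+
    then show False using not_planar \<open>W = {}\<close> by blast
  qed

  let ?R = "(\<Sum>c\<in>W. norm c) + 1"
  have R: "?R > 0" by (simp add: add_nonneg_pos sum_nonneg)
  have deg: "finite C" "(\<Sum>x\<in>C. sgn (det (hessian F x))) = 1"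
    using sum_sgn_det_jacobian_eq_1[OF polynomial_function_gradient[OF poly]
        gradient_dist_product_outward[OF \<open>W \<noteq> {}\<close>] R] nz
    by (simp_all add: C transpose_hessian[OF poly] flip: hessian_eq_jacobian[OF poly])
  have "W \<subseteq> C" by (auto simp: C gradient_dist_product_zero)
  have min: "{x. \<forall>y. F x \<le> F y} = W"
  proof (intro equalityI subsetI)
    fix x assume x: "x \<in> {x. \<forall>y. F x \<le> F y}"
    obtain c where "c \<in> W" using \<open>W \<noteq> {}\<close> by blast
    have "F x \<le> F c" using x by blast
    then have "F x \<le> 0" using dist_product_eq_0_iff[of c] \<open>c \<in> W\<close> by simp
    then show "x \<in> W" using dist_product_nonneg[of x] dist_product_eq_0_iff[of x] by simp
  next
    fix x assume "x \<in> W"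
    then show "x \<in> {x. \<forall>y. F x \<le> F y}"
      using dist_product_eq_0_iff[of x] dist_product_nonneg by simp
  qed
  \<comment> \<open>\<open>C - S\<close> consists of \<open>W\<close> and \<open>M\<close>, so all
    its points contribute the sign \<open>+1\<close>.\<close>
  have local_min: "local_min_at F x" if "x \<in> C - S" for x
  proof (cases "x \<in> W")
    case True
    then have "\<forall>y. F x \<le> F y" using min by blast
    then show ?thesis unfolding local_min_at_def using zero_less_one by blast
  next
    case False
    then show ?thesis using that by (auto simp: S_def M_def)
  qed
  have saddle: "negativity_index (hessian F x) = 1" "sgn (det (hessian F x)) = -1" if "x \<in> S" for x
  proof -
    have x: "x \<in> C" "x \<notin> W" "\<not> local_min_at F x" "gradient F x = 0"
      using that by (auto simp: S_def M_def C)
    show "negativity_index (hessian F x) = 1" "sgn (det (hessian F x)) = -1"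
      by (rule saddle_index_one[OF poly x(3,4) nz[OF x(1)]
            hessian_dist_product_trace_pos[OF x(2,4) _ _ _ not_planar]]; assumption)+
  qed
  have "(\<Sum>x\<in>C. sgn (det (hessian F x))) = real (card (C - S)) - real (card S)"
  proof (rule sgn_sum_partition[OF deg(1)])
    show "S \<subseteq> C" by (auto simp: S_def)
    fix x assume "x \<in> C - S"
    then show "sgn (det (hessian F x)) = 1"
      using sgn_det_hessian_local_min[OF poly local_min] nz by (simp add: C)
  qed (rule saddle)
  moreover have "C - S = W \<union> M" using \<open>W \<subseteq> C\<close> by (auto simp: S_def M_def)
  moreover have "card (W \<union> M) = card W + card M"
    using fin deg(1) by (intro card_Un_disjoint) (auto simp: M_def)
  \<comment> \<open>Over the reals the degree identity reads
    \<open>card W + card M - card S = 1\<close>, so the subtraction on natural numbers is not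
    truncated.\<close>
  ultimately have "card S = card W + card M - 1" using deg(2) by simp
  then show ?thesis
    using deg(1) \<open>W \<subseteq> C\<close> min saddle(1)
    unfolding Let_def C_def[symmetric] M_def[symmetric] S_def[symmetric] by blast
qed

end

text \<open>The number \<open>h\<close> is \<open>card M\<close>. As \<open>S\<close> is everything
  left in \<open>C\<close>, the index claim for all of \<open>S\<close> also says that no other
  critical points exist.\<close>

theorem theorem0p2:
  fixes w :: "nat \<Rightarrow> real^'n" and r :: nat
  assumes N3: "CARD('n) \<ge> 3"
    and distinct: "inj_on w {1..r}"
    and not_planar: "\<not> (\<exists>P. affine P \<and> aff_dim P = 2 \<and> w ` {1..r} \<subseteq> P)"
    and morse: "\<forall>x. critical_point (\<lambda>x. \<Prod>j\<in>{1..r}. (norm (x - w j))\<^sup>2) x \<longrightarrow>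
                     det (hessian (\<lambda>x. \<Prod>j\<in>{1..r}. (norm (x - w j))\<^sup>2) x) \<noteq> 0"
  shows "let F = (\<lambda>x. \<Prod>j\<in>{1..r}. (norm (x - w j))\<^sup>2);
             C = {x. critical_point F x};
             W = w ` {1..r};
             M = {x \<in> C - W. local_min_at F x};
             S = C - W - M
         in finite C \<and> W \<subseteq> C \<and> {x. \<forall>y. F x \<le> F y} = W \<and>
            card S = r + card M - 1 \<and>
            (\<forall>x\<in>S. negativity_index (hessian F x) = 1)"
proof -
  \<comment> \<open>Injectivity of \<open>w\<close> turns the product over indices into one over the
    set of points, where no factor is repeated.\<close>
  have F: "(\<lambda>x. \<Prod>j\<in>{1..r}. (norm (x - w j))\<^sup>2) = (\<lambda>x. \<Prod>c\<in>w ` {1..r}. (norm (x - c))\<^sup>2)"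
    using distinct by (simp add: prod.reindex)
  have "card (w ` {1..r}) = r" using distinct by (simp add: card_image)
  from dist_product_critical_points[OF finite_imageI[OF finite_atLeastAtMost] N3 not_planar
      morse[unfolded F], unfolded this]
  show ?thesis unfolding F Let_def .
qed

end
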